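(* Let $\alpha\in(0,1)$, $\lambda\in\mathbb{R}$, $x_0>0$, and consider the fractional ODE $D_c^\alpha X=\lambda X$, $X(0)=x_0$, whose solution is $X(t)=x_0E_\alpha(\lambda t^\alpha)$. For a time step $k>0$, with $t_n=nk$, consider the implicit scheme with $X_0=x_0$ and, for $n\ge1$, $$(\mathcal{D}^\alpha X)_n=\lambda X_n\iff X_n=X_0+\lambda k^\alpha\sum_{m=1}^na_{n-m}X_m.$$ (1) If $\lambda>0$ and $k^\alpha\lambda<c_0$, then $X(t_n)\le X_n\le X_{n+1}$ for all $n\ge0$. If $\lambda<0$, then $\lim_{n\to\infty}X_n=0$. (2) Let $\lambda>0$. Suppose $k_i$, $i=1,2$, satisfy $k_i^\alpha\lambda<c_0$ and $k_1=2^{m_1}k_2$ for some $m_1\in\mathbb{N}$. Let $\{X_n^{(i)}\}$ be the numerical solution with step $k_i$, and define the piecewise constant functions $\bar X_i(t)=X_n^{(i)}$ for $t\in(t_{n-1}^{(i)},t_n^{(i)}]$, where $t_n^{(i)}=nk_i$. Then $\bar X_1(t)\ge\bar X_2(t)$ for all $t>0$. Consequently, for every $T>0$ there exists a constant $C(\alpha,T)>0$ (which may depend on the fixed $\lambda$, but not on $k$) such that for any $k$ with $k^\alpha\lambda\le\frac12c_0$, $$\sup_{n:\,nk\le T}X_n\le C(\alpha,T)X_0.$$ (3) For every $T>0$ there is a constant $C_1(\alpha,T)$ (which may depend on the fixed $\lambda$ and $x_0$, but not on $k$) such that for all sufficiently small $k$, $$\sup_{n:\,nk\le T}|X_n-X(t_n)|\le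 C_1(\alpha,T)k^\alpha.$$
   Context: $D_c^\alpha$ is the Caputo derivative; the fractional ODE is equivalent to $X(t)=x_0+\frac{\lambda}{\Gamma(\alpha)}\int_0^t(t-s)^{\alpha-1}X(s)\,ds$. The Mittag-Leffler function is $E_\alpha(z)=\sum_{n=0}^\infty\frac{z^n}{\Gamma(n\alpha+1)}$. Discretization: $a_n=\frac{(n+1)^\alpha-n^\alpha}{\Gamma(1+\alpha)}$ for $n\ge0$; $a^{(-1)}$ is the convolution inverse of $a$, i.e. $a*a^{(-1)}=(1,0,0,\ldots)$ with $(p*q)_n=\sum_{m=0}^np_mq_{n-m}$; $c_0=a^{(-1)}_0=\Gamma(1+\alpha)$, $c_i=-a_i^{(-1)}$ for $i\ge1$, $c_n^n=c_0-\sum_{i=1}^{n-1}c_i$ for $n\ge1$; and $(\mathcal{D}^\alpha X)_n=k^{-\alpha}\big(c_0X_n-\sum_{i=1}^{n-1}c_iX_{n-i}-c_n^nX_0\big)$ for $n\ge1$. *)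

theory Defs
  imports "HOL-Analysis.Analysis"
begin

text \<open>
  The classical Caputo derivative for order \<open>0 < \<alpha> < 1\<close>. A solution of the initial value problem is
  continuous on \<open>[0, \<infinity>)\<close>, differentiable on \<open>(0, \<infinity>)\<close> (not necessarily at \<open>0\<close>, where typical
  solutions behave like \<open>t powr \<alpha>\<close>), and such that the Caputo derivative exists as a Lebesgue
  integral. The values of the integrand at the end points are immaterial.
\<close>

definition caputo_deriv :: "real \<Rightarrow> (real \<Rightarrow> real) \<Rightarrow> real \<Rightarrow> real" where
  "caputo_deriv \<alpha> X t =
     1 / Gamma (1 - \<alpha>) * integral {0..t} (\<lambda>s. deriv X s / (t - s) powr \<alpha>)"

definition fode_solution :: "real \<Rightarrow> real \<Rightarrow> real \<Rightarrow> (real \<Rightarrow> real) \<Rightarrow> bool" where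
  "fode_solution \<alpha> lam x0 X \<longleftrightarrow>
     X 0 = x0 \<and> continuous_on {0..} X \<and> (\<forall>t>0. X differentiable (at t)) \<and>
     (\<forall>t>0. (\<lambda>s. deriv X s / (t - s) powr \<alpha>) absolutely_integrable_on {0..t} \<and>
            caputo_deriv \<alpha> X t = lam * X t)"

definition mittag_leffler :: "real \<Rightarrow> real \<Rightarrow> real" where
  "mittag_leffler \<alpha> z = (\<Sum>n. z ^ n / Gamma (real n * \<alpha> + 1))"

definition exact_sol :: "real \<Rightarrow> real \<Rightarrow> real \<Rightarrow> real \<Rightarrow> real" where
  "exact_sol \<alpha> lam x0 t = x0 * mittag_leffler \<alpha> (lam * t powr \<alpha>)"

definition conv :: "(nat \<Rightarrow> real) \<Rightarrow> (nat \<Rightarrow> real) \<Rightarrow> nat \<Rightarrow> real" where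
  "conv p q n = (\<Sum>m=0..n. p m * q (n - m))"

definition conv_inverse :: "(nat \<Rightarrow> real) \<Rightarrow> nat \<Rightarrow> real" where
  "conv_inverse p = (THE q. conv p q = (\<lambda>n. if n = 0 then 1 else 0))"

lemma conv_eq_fps_mult: "conv p q n = fps_nth (Abs_fps p * Abs_fps q) n"
  by (simp add: conv_def fps_mult_nth)

lemma conv_inverse_eq_fps:
  assumes "p 0 \<noteq> 0"
  shows "conv_inverse p = fps_nth (inverse (Abs_fps p))"
    and "conv p (conv_inverse p) = (\<lambda>n. if n = 0 then 1 else 0)"
proof -
  have nz: "fps_nth (Abs_fps p) 0 \<noteq> 0" using assms by simp
  have iff: "conv p q = (\<lambda>n. if n = 0 then 1 else 0) \<longleftrightarrow> Abs_fps p * Abs_fps q = 1" for q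
    by (auto simp: fun_eq_iff fps_eq_iff conv_eq_fps_mult)
  have ex: "conv p (fps_nth (inverse (Abs_fps p))) = (\<lambda>n. if n = 0 then 1 else 0)"
    unfolding iff by (simp add: fps_nth_inverse inverse_mult_eq_1'[OF nz])
  have uniq: "q = fps_nth (inverse (Abs_fps p))"
    if "conv p q = (\<lambda>n. if n = 0 then 1 else 0)" for q
  proof -
    have "Abs_fps q = inverse (Abs_fps p)"
      using that unfolding iff by (metis fps_inverse_unique)
    then show ?thesis by (metis fps_nth_Abs_fps ext)
  qed
  show eq: "conv_inverse p = fps_nth (inverse (Abs_fps p))"
    unfolding conv_inverse_def using ex uniq by (rule the_equality)
  show "conv p (conv_inverse p) = (\<lambda>n. if n = 0 then 1 else 0)"
    unfolding eq by (rule ex)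
qed

definition coeff_a :: "real \<Rightarrow> nat \<Rightarrow> real" where
  "coeff_a \<alpha> n = ((real n + 1) powr \<alpha> - real n powr \<alpha>) / Gamma (1 + \<alpha>)"

definition coeff_c :: "real \<Rightarrow> nat \<Rightarrow> real" where
  "coeff_c \<alpha> i =
     (if i = 0 then conv_inverse (coeff_a \<alpha>) 0 else - conv_inverse (coeff_a \<alpha>) i)"

lemma coeff_c_0:
  assumes "0 < \<alpha>"
  shows "coeff_c \<alpha> 0 = Gamma (1 + \<alpha>)"
proof -
  have "Gamma (1 + \<alpha>) > 0" using assms by (intro Gamma_real_pos) simp
  then have "coeff_a \<alpha> 0 \<noteq> 0" by (simp add: coeff_a_def)
  from conv_inverse_eq_fps(1)[of "coeff_a \<alpha>", OF this] show ?thesis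
    by (simp add: coeff_c_def) (simp add: coeff_a_def)
qed

text \<open>The coefficient \<open>c\<^sub>n\<^sup>n\<close> multiplying the initial value.\<close>

definition coeff_c_init :: "real \<Rightarrow> nat \<Rightarrow> real" where
  "coeff_c_init \<alpha> n = coeff_c \<alpha> 0 - (\<Sum>i=1..<n. coeff_c \<alpha> i)"

definition discrete_caputo :: "real \<Rightarrow> real \<Rightarrow> (nat \<Rightarrow> real) \<Rightarrow> nat \<Rightarrow> real" where
  "discrete_caputo \<alpha> k X n =
     k powr (- \<alpha>) *
       (coeff_c \<alpha> 0 * X n - (\<Sum>i=1..<n. coeff_c \<alpha> i * X (n - i)) - coeff_c_init \<alpha> n * X 0)"

definition implicit_scheme :: "real \<Rightarrow> real \<Rightarrow> real \<Rightarrow> real \<Rightarrow> (nat \<Rightarrow> real) \<Rightarrow> bool" where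
  "implicit_scheme \<alpha> lam k x0 X \<longleftrightarrow>
     X 0 = x0 \<and> (\<forall>n\<ge>1. discrete_caputo \<alpha> k X n = lam * X n)"

text \<open>The value at \<open>t > 0\<close> is \<open>X n\<close> for the unique \<open>n \<ge> 1\<close> with \<open>t\<close> in \<open>((n - 1) k, n k]\<close>.\<close>

definition pw_const :: "real \<Rightarrow> (nat \<Rightarrow> real) \<Rightarrow> real \<Rightarrow> real" where
  "pw_const k X t = X (THE n. n \<ge> 1 \<and> t \<in> {(real n - 1) * k <.. real n * k})"

lemma pw_const_eq:
  assumes "0 < k" "n \<ge> 1" "t \<in> {(real n - 1) * k <.. real n * k}"
  shows "pw_const k X t = X n"
proof -
  have "m = n" if m: "m \<ge> 1" "t \<in> {(real m - 1) * k <.. real m * k}" for m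
  proof -
    have "(real m - 1) * k < real n * k" "(real n - 1) * k < real m * k"
      using m assms by (meson greaterThanAtMost_iff less_le_trans)+
    then have "real m - 1 < real n" "real n - 1 < real m"
      using \<open>0 < k\<close> by (simp_all only: mult_less_cancel_right_pos)
    then show ?thesis by linarith
  qed
  with assms have "(THE n. n \<ge> 1 \<and> t \<in> {(real n - 1) * k <.. real n * k}) = n"
    by (intro the_equality) blast+
  then show ?thesis by (simp add: pw_const_def)
qed

end

theory Submission
  imports Defs "HOL-Real_Asymp.Real_Asymp"
begin

text \<open>
  Everything is read off the Volterra forms \<open>X n = X 0 + h * (a * X) n\<close> and
  \<open>X = x0 + lam * J\<^sup>\<alpha> X\<close>, with \<open>J\<^sup>\<alpha>\<close> the Riemann-Liouville integral. If \<open>h * a 0 < 1\<close>, a subsolution of the discrete equation lies below a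
  supersolution. The shifted solution, the solution on a coarser grid and the geometric sequence
  \<open>exp (\<mu> * t)\<close> are supersolutions, and the exact solution is a subsolution; this gives monotonicity in
  \<open>n\<close> and in the step size, a discrete Gronwall inequality and the lower bound. For \<open>lam < 0\<close>,
  log-convexity of \<open>a\<close> makes \<open>X\<close> and its decrements nonnegative; as
  \<open>X 0 \<ge> \<bar>h\<bar> * X n * (a 0 + \<dots> + a (n - 1))\<close> and the sum diverges, \<open>X\<close> tends to \<open>0\<close>. The error bound is
  Gronwall applied to the consistency error, which is of order \<open>k powr \<alpha>\<close> because the exact solution is
  \<open>\<alpha>\<close>-Hoelder. A solution of the differential equation satisfies the Volterra equation because
  \<open>J\<^sup>\<alpha> J\<^sup>1\<^sup>-\<^sup>\<alpha> = J\<^sup>1\<close>, and the Volterra equation has only one continuous solution.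
\<close>

section \<open>Discrete Volterra equations\<close>

definition volterra_conv :: "(nat \<Rightarrow> real) \<Rightarrow> (nat \<Rightarrow> real) \<Rightarrow> nat \<Rightarrow> real" where
  "volterra_conv a u n = (\<Sum>m=1..n. a (n - m) * u m)"

lemma volterra_conv_0 [simp]: "volterra_conv a u 0 = 0"
  by (simp add: volterra_conv_def)

lemma volterra_conv_reflect: "volterra_conv a u n = (\<Sum>j<n. a j * u (n - j))"
  unfolding volterra_conv_def
  by (rule sum.reindex_bij_witness[where i = "\<lambda>j. n - j" and j = "\<lambda>m. n - m"]) auto

lemma volterra_conv_const: "volterra_conv a (\<lambda>_. x) n = (\<Sum>j<n. a j) * x"
  by (simp add: volterra_conv_reflect sum_distrib_right)

lemma volterra_conv_add:
  "volterra_conv a (\<lambda>i. u i + v i) n = volterra_conv a u n + volterra_conv a v n"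
  by (simp add: volterra_conv_def distrib_left sum.distrib)

lemma volterra_conv_diff:
  "volterra_conv a (\<lambda>i. u i - v i) n = volterra_conv a u n - volterra_conv a v n"
  by (simp add: volterra_conv_def right_diff_distrib sum_subtractf)

lemma volterra_conv_Suc_last:
  "volterra_conv a u (Suc n) = (\<Sum>m=1..n. a (Suc n - m) * u m) + a 0 * u (Suc n)"
  by (simp add: volterra_conv_def)

lemma volterra_conv_Suc_shift:
  "volterra_conv a u (Suc n) = a n * u 1 + volterra_conv a (\<lambda>i. u (Suc i)) n"
proof -
  have "volterra_conv a u (Suc n) = a n * u 1 + (\<Sum>m=Suc 1..Suc n. a (Suc n - m) * u m)"
    unfolding volterra_conv_def by (subst sum.atLeast_Suc_atMost) auto
  then show ?thesis
    unfolding volterra_conv_def by (subst (asm) sum.shift_bounds_cl_Suc_ivl) simp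
qed

lemma abs_volterra_conv_le:
  assumes "\<And>j. 0 \<le> a j"
  shows "\<bar>volterra_conv a u n\<bar> \<le> volterra_conv a (\<lambda>i. \<bar>u i\<bar>) n"
  unfolding volterra_conv_def using assms
  by (intro order_trans[OF sum_abs]) (simp add: abs_mult)

lemma volterra_conv_incseq:
  assumes a: "\<And>j. 0 \<le> a j" and u: "\<And>i. 0 \<le> u i" "incseq u"
  shows "incseq (volterra_conv a u)"
proof (rule incseq_SucI)
  fix n
  have "volterra_conv a u n \<le> volterra_conv a (\<lambda>i. u (Suc i)) n"
    unfolding volterra_conv_def by (intro sum_mono mult_left_mono a incseq_SucD[OF u(2)])
  also have "\<dots> \<le> volterra_conv a u (Suc n)"
    using a u by (simp add: volterra_conv_Suc_shift)
  finally show "volterra_conv a u n \<le> volterra_conv a u (Suc n)" .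
qed

lemma volterra_perturbation_le:
  fixes a X y :: "nat \<Rightarrow> real"
  assumes a: "\<And>j. 0 \<le> a j" and X: "X n = x0 + h * volterra_conv a X n"
    and y: "\<bar>y n - (x0 + h * volterra_conv a y n)\<bar> \<le> \<delta>"
  shows "\<bar>X n - y n\<bar> \<le> \<delta> + \<bar>h\<bar> * volterra_conv a (\<lambda>i. \<bar>X i - y i\<bar>) n"
proof -
  have "X n - y n = h * volterra_conv a (\<lambda>i. X i - y i) n - (y n - (x0 + h * volterra_conv a y n))"
    using X by (simp add: volterra_conv_diff right_diff_distrib)
  then have "\<bar>X n - y n\<bar> \<le> \<delta> + \<bar>h * volterra_conv a (\<lambda>i. X i - y i) n\<bar>"
    using y by linarith
  also have "\<dots> \<le> \<delta> + \<bar>h\<bar> * volterra_conv a (\<lambda>i. \<bar>X i - y i\<bar>) n"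
    unfolding abs_mult by (intro add_left_mono mult_left_mono abs_volterra_conv_le a) auto
  finally show ?thesis .
qed

locale nonneg_volterra_kernel =
  fixes a :: "nat \<Rightarrow> real" and h :: real
  assumes kernel_nonneg: "0 \<le> a j"
    and factor_nonneg: "0 \<le> h"
    and implicit_factor_less_1: "h * a 0 < 1"
begin

lemma subsolution_le_supersolution:
  assumes sub: "\<And>i. 1 \<le> i \<Longrightarrow> i \<le> N \<Longrightarrow> u i \<le> g i + h * volterra_conv a u i"
    and super: "\<And>i. 1 \<le> i \<Longrightarrow> i \<le> N \<Longrightarrow> g i + h * volterra_conv a v i \<le> v i"
    and "1 \<le> n" "n \<le> N"
  shows "u n \<le> v n"
  using \<open>1 \<le> n\<close> \<open>n \<le> N\<close>
proof (induction n rule: less_induct)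
  case (less n)
  then obtain l where n: "n = Suc l" by (cases n) auto
  have earlier: "(\<Sum>m=1..l. a (n - m) * u m) \<le> (\<Sum>m=1..l. a (n - m) * v m)"
    using less n by (intro sum_mono mult_left_mono kernel_nonneg) auto
  have "u n - v n \<le> h * (volterra_conv a u n - volterra_conv a v n)"
    using sub[OF less.prems] super[OF less.prems] by (simp add: right_diff_distrib)
  also have "\<dots> \<le> h * (a 0 * (u n - v n))"
    using earlier unfolding n volterra_conv_Suc_last
    by (intro mult_left_mono factor_nonneg) (simp add: right_diff_distrib)
  finally have "(1 - h * a 0) * (u n - v n) \<le> 0"
    by (simp add: algebra_simps)
  then show ?case
    using implicit_factor_less_1 by (simp add: mult_le_0_iff)
qed

context
  fixes X :: "nat \<Rightarrow> real" and x0 :: real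
  assumes solution: "\<And>n. X n = x0 + h * volterra_conv a X n"
    and initial_nonneg: "0 \<le> x0"
begin

lemma solution_nonneg: "0 \<le> X n"
proof (cases n)
  case 0
  then show ?thesis using solution[of 0] initial_nonneg by simp
next
  case (Suc l)
  then show ?thesis
    using subsolution_le_supersolution[of n "\<lambda>_. 0" "\<lambda>_. x0" X n] solution initial_nonneg
    by (simp add: volterra_conv_const)
qed

text \<open>The shifted sequence is a supersolution.\<close>

lemma solution_incseq: "incseq X"
proof (rule incseq_SucI)
  fix n
  have shift: "x0 + h * volterra_conv a (\<lambda>i. X (Suc i)) i \<le> X (Suc i)" for i
    using solution[of "Suc i"] factor_nonneg kernel_nonneg[of i] solution_nonneg[of 1]
    by (simp add: volterra_conv_Suc_shift distrib_left)
  show "X n \<le> X (Suc n)"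
  proof (cases n)
    case 0
    then show ?thesis using shift[of 0] solution[of 0] by simp
  next
    case (Suc l)
    then show ?thesis
      using subsolution_le_supersolution[of n X "\<lambda>_. x0" "\<lambda>i. X (Suc i)" n] solution shift by simp
  qed
qed

end

lemma geometric_gronwall:
  assumes q: "0 < q" "q \<le> 1"
    and weighted: "\<And>i. i \<le> N \<Longrightarrow> h * (\<Sum>j<i. a j * q ^ j) \<le> \<theta>" and "\<theta> < 1"
    and "0 \<le> R" and sub: "\<And>i. 1 \<le> i \<Longrightarrow> i \<le> N \<Longrightarrow> u i \<le> R + h * volterra_conv a u i"
    and n: "1 \<le> n" "n \<le> N"
  shows "u n \<le> R / (1 - \<theta>) / q ^ n"
proof -
  define v where "v i = R / (1 - \<theta>) / q ^ i" for i
  have v_nonneg: "0 \<le> v i" for i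
    using assms by (simp add: v_def)
  have R_le: "R \<le> (1 - \<theta>) * v i" for i
  proof -
    have "R * q ^ i \<le> R * 1"
      using q \<open>0 \<le> R\<close> by (intro mult_left_mono power_le_one) auto
    moreover have "(1 - \<theta>) * v i = R / q ^ i" using \<open>\<theta> < 1\<close> by (simp add: v_def)
    ultimately show ?thesis using q by (simp add: le_divide_eq)
  qed
  have conv_v: "volterra_conv a v i = (\<Sum>j<i. a j * q ^ j) * v i" for i
    unfolding volterra_conv_reflect sum_distrib_right using q
    by (intro sum.cong) (auto simp: v_def power_diff)
  have "R + h * volterra_conv a v i \<le> v i" if "i \<le> N" for i
    using mult_right_mono[OF weighted[OF that] v_nonneg[of i]] R_le[of i]
    by (simp add: conv_v algebra_simps)
  from subsolution_le_supersolution[OF sub this n] show ?thesis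
    by (simp add: v_def)
qed

end

subsection \<open>Coarsening\<close>

definition ceil_div :: "nat \<Rightarrow> nat \<Rightarrow> nat" where
  "ceil_div m N = (m + (N - 1)) div N"

lemma ceil_div_le_iff:
  assumes "0 < N"
  shows "ceil_div m N \<le> n \<longleftrightarrow> m \<le> n * N"
proof -
  have "ceil_div m N \<le> n \<longleftrightarrow> m + (N - 1) < Suc n * N"
    unfolding ceil_div_def using assms by (metis div_less_iff_less_mult less_Suc_eq_le)
  then show ?thesis using assms by auto
qed

lemma ceil_div_mono: "m \<le> n \<Longrightarrow> ceil_div m N \<le> ceil_div n N"
  by (simp add: ceil_div_def div_le_mono)

lemma ceil_div_block:
  assumes "i < l" "j \<in> {i * N..<i * N + N}"
  shows "ceil_div (l * N - j) N = l - i"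
proof -
  have N: "0 < N" using assms(2) by simp
  obtain d where l: "l = Suc i + d" using assms(1) less_iff_Suc_add by auto
  show ?thesis
  proof (rule antisym)
    show "ceil_div (l * N - j) N \<le> l - i"
      unfolding ceil_div_le_iff[OF N] using assms l by (auto simp: algebra_simps)
    have "\<not> ceil_div (l * N - j) N \<le> d"
      unfolding ceil_div_le_iff[OF N] using assms l by (auto simp: algebra_simps)
    then show "l - i \<le> ceil_div (l * N - j) N" using l by simp
  qed
qed

definition coarse_kernel :: "nat \<Rightarrow> (nat \<Rightarrow> real) \<Rightarrow> nat \<Rightarrow> real" where
  "coarse_kernel N a i = (\<Sum>j=i*N..<i*N+N. a j)"

lemma volterra_conv_ceil_div:
  "volterra_conv a (\<lambda>m. X (ceil_div m N)) (l * N) = volterra_conv (coarse_kernel N a) X l"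
proof -
  have "volterra_conv a (\<lambda>m. X (ceil_div m N)) (l * N) =
      (\<Sum>i<l. \<Sum>j=i*N..<i*N+N. a j * X (ceil_div (l * N - j) N))"
    by (simp add: volterra_conv_reflect sum.nat_group)
  also have "\<dots> = (\<Sum>i<l. coarse_kernel N a i * X (l - i))"
    unfolding coarse_kernel_def sum_distrib_right by (intro sum.cong refl) (simp only: ceil_div_block lessThan_iff)
  finally show ?thesis by (simp add: volterra_conv_reflect)
qed

text \<open>The coarse solution, extended to the fine grid as a step function, is a supersolution there: at the
  coarse nodes the two convolutions agree, and in between the fine one is nondecreasing.\<close>

lemma (in nonneg_volterra_kernel) solution_le_coarse_solution:
  assumes "0 < N" and coarse: "nonneg_volterra_kernel (coarse_kernel N a) h"
    and X: "\<And>n. X n = x0 + h * volterra_conv a X n"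
    and Z: "\<And>n. Z n = x0 + h * volterra_conv (coarse_kernel N a) Z n"
    and "0 \<le> x0" "m \<le> n * N"
  shows "X m \<le> Z n"
proof -
  interpret coarse: nonneg_volterra_kernel "coarse_kernel N a" h by (fact coarse)
  note Z_nonneg = coarse.solution_nonneg[OF Z \<open>0 \<le> x0\<close>]
  have Z_mono: "Z i \<le> Z j" if "i \<le> j" for i j
    using coarse.solution_incseq[OF Z \<open>0 \<le> x0\<close>] that by (rule incseqD)
  define Y where "Y i = Z (ceil_div i N)" for i
  have Y_incseq: "incseq Y"
    unfolding Y_def by (intro monoI Z_mono ceil_div_mono)
  have super: "x0 + h * volterra_conv a Y i \<le> Y i" for i
  proof -
    have "i \<le> ceil_div i N * N"
      using ceil_div_le_iff[OF \<open>0 < N\<close>] by blast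
    then have "volterra_conv a Y i \<le> volterra_conv a Y (ceil_div i N * N)"
      using volterra_conv_incseq[of a Y] kernel_nonneg Z_nonneg Y_incseq
      by (simp add: Y_def incseq_def)
    then have "x0 + h * volterra_conv a Y i \<le> x0 + h * volterra_conv a Y (ceil_div i N * N)"
      by (intro add_left_mono mult_left_mono factor_nonneg)
    also have "\<dots> = Y i"
      unfolding Y_def volterra_conv_ceil_div by (rule Z[symmetric])
    finally show ?thesis .
  qed
  have "X m \<le> Y m"
  proof (cases m)
    case 0
    then show ?thesis using X[of 0] super[of 0] by simp
  next
    case (Suc l)
    then show ?thesis
      using subsolution_le_supersolution[of m X "\<lambda>_. x0" Y m] X super by simp
  qed
  also have "Y m \<le> Z n"
    unfolding Y_def using \<open>0 < N\<close> \<open>m \<le> n * N\<close> by (intro Z_mono) (simp add: ceil_div_le_iff)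
  finally show ?thesis .
qed

subsection \<open>Log-convex kernels\<close>

lemma damped_solution_Suc:
  fixes u g a :: "nat \<Rightarrow> real"
  assumes "\<And>n. u n = g n - h * volterra_conv a u n"
  shows "(1 + h * a 0) * u (Suc n) = r * u n + (g (Suc n) - r * g n)
    + h * (\<Sum>m=1..n. (r * a (n - m) - a (Suc n - m)) * u m)"
proof -
  have "(1 + h * a 0) * u (Suc n) = g (Suc n) - h * (\<Sum>m=1..n. a (Suc n - m) * u m)"
    using assms[of "Suc n"] unfolding volterra_conv_Suc_last by (simp add: algebra_simps)
  moreover have "r * u n = r * g n - h * (r * volterra_conv a u n)"
    using assms[of n] by (metis mult.left_commute right_diff_distrib)
  moreover have "r * volterra_conv a u n - (\<Sum>m=1..n. a (Suc n - m) * u m)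
      = (\<Sum>m=1..n. (r * a (n - m) - a (Suc n - m)) * u m)"
    by (simp add: volterra_conv_def sum_distrib_left sum_subtractf algebra_simps)
  ultimately show ?thesis by (simp add: algebra_simps)
qed

locale log_convex_kernel =
  fixes a :: "nat \<Rightarrow> real"
  assumes kernel_pos: "0 < a n"
    and log_convex: "(a (Suc n))\<^sup>2 \<le> a n * a (Suc (Suc n))"
begin

lemma ratio_mono:
  assumes "m \<le> n"
  shows "a (Suc m) / a m \<le> a (Suc n) / a n"
proof (rule lift_Suc_mono_le[OF _ assms])
  show "a (Suc i) / a i \<le> a (Suc (Suc i)) / a (Suc i)" for i
    using log_convex[of i] kernel_pos[of i] kernel_pos[of "Suc i"]
    by (simp add: field_simps power2_eq_square)
qed

text \<open>Choosing \<open>r\<close> as the kernel ratio at \<open>n\<close> in the recursion makes all its coefficients nonnegative.\<close>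

lemma damped_solution_nonneg:
  assumes u: "\<And>n. u n = g n - h * volterra_conv a u n" and "0 \<le> h"
    and g: "0 \<le> g 0" "\<And>n. a (Suc n) / a n * g n \<le> g (Suc n)"
  shows "0 \<le> u n"
proof (induction n rule: less_induct)
  case (less n)
  show ?case
  proof (cases n)
    case 0
    then show ?thesis using u[of 0] g by simp
  next
    case (Suc l)
    define r where "r = a (Suc l) / a l"
    have coeff_nonneg: "0 \<le> r * a (l - m) - a (Suc l - m)" if "m \<le> l" for m
      using ratio_mono[of "l - m" l] kernel_pos[of "l - m"] that
      by (simp add: r_def field_simps Suc_diff_le)
    have "0 \<le> r * u l"
      using less.IH[of l] Suc kernel_pos by (simp add: r_def less_imp_le)
    moreover have "0 \<le> g (Suc l) - r * g l"
      using g by (simp add: r_def)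
    moreover have "0 \<le> h * (\<Sum>m=1..l. (r * a (l - m) - a (Suc l - m)) * u m)"
      using coeff_nonneg less.IH Suc \<open>0 \<le> h\<close> by (intro mult_nonneg_nonneg sum_nonneg) auto
    ultimately have "0 \<le> (1 + h * a 0) * u (Suc l)"
      unfolding damped_solution_Suc[OF u, of l r] by simp
    moreover have "0 < 1 + h * a 0"
      using \<open>0 \<le> h\<close> kernel_pos[of 0] by (simp add: add_pos_nonneg)
    ultimately show ?thesis using Suc by (simp add: zero_le_mult_iff)
  qed
qed

context
  fixes h x0 :: real and X :: "nat \<Rightarrow> real"
  assumes antimono: "\<And>n. a (Suc n) \<le> a n"
    and damping: "0 < h" and initial_nonneg: "0 \<le> x0"
    and solution: "\<And>n. X n = x0 - h * volterra_conv a X n"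
begin

lemma relaxation_nonneg: "0 \<le> X n"
proof (rule damped_solution_nonneg[OF solution])
  show "a (Suc i) / a i * x0 \<le> x0" for i
    using antimono kernel_pos initial_nonneg
    by (intro mult_left_le_one_le) (auto simp: less_imp_le)
qed (use damping initial_nonneg in auto)

text \<open>The decrements solve the same equation with forcing term proportional to the kernel.\<close>

lemma relaxation_decseq: "decseq X"
proof (rule decseq_SucI)
  fix n
  have "0 \<le> X n - X (Suc n)"
  proof (rule damped_solution_nonneg[where u = "\<lambda>i. X i - X (Suc i)"])
    show "X i - X (Suc i) = h * X 1 * a i - h * volterra_conv a (\<lambda>i. X i - X (Suc i)) i" for i
      using solution[of i] solution[of "Suc i"]
      by (simp add: volterra_conv_Suc_shift volterra_conv_diff algebra_simps)
    show "a (Suc i) / a i * (h * X 1 * a i) \<le> h * X 1 * a (Suc i)" for i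
      using kernel_pos[of i] by simp
  qed (use damping relaxation_nonneg kernel_pos in \<open>auto simp: less_imp_le\<close>)
  then show "X (Suc n) \<le> X n" by simp
qed

lemma relaxation_le: "h * (\<Sum>j<n. a j) * X n \<le> x0"
proof -
  have "(\<Sum>j<n. a j) * X n \<le> volterra_conv a X n"
    unfolding volterra_conv_reflect sum_distrib_right using kernel_pos
    by (intro sum_mono mult_left_mono decseqD[OF relaxation_decseq]) (auto simp: less_imp_le)
  then have "h * ((\<Sum>j<n. a j) * X n) \<le> h * volterra_conv a X n"
    using damping by (intro mult_left_mono) auto
  then show ?thesis using solution[of n] relaxation_nonneg[of n] by (simp add: mult.assoc)
qed

lemma relaxation_tendsto_0:
  assumes "filterlim (\<lambda>n. \<Sum>j<n. a j) at_top sequentially"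
  shows "X \<longlonglongrightarrow> 0"
proof (rule tendsto_sandwich[OF _ _ tendsto_const])
  have "\<forall>\<^sub>F n in sequentially. 0 < (\<Sum>j<n. a j)"
    using assms by (simp add: filterlim_at_top_dense)
  then show "\<forall>\<^sub>F n in sequentially. X n \<le> x0 / h / (\<Sum>j<n. a j)"
  proof eventually_elim
    case (elim n)
    then show ?case using relaxation_le[of n] damping by (simp add: field_simps)
  qed
  show "(\<lambda>n. x0 / h / (\<Sum>j<n. a j)) \<longlonglongrightarrow> 0"
    by (rule real_tendsto_divide_at_top[OF tendsto_const assms])
qed (use relaxation_nonneg in auto)

end

end

section \<open>The coefficients of the scheme\<close>

lemma coeff_a_pos:
  assumes "0 < \<alpha>"
  shows "0 < coeff_a \<alpha> n"
  using assms unfolding coeff_a_def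
  by (intro divide_pos_pos Gamma_real_pos) (auto intro!: powr_less_mono2)

lemma coeff_a_0: "coeff_a \<alpha> 0 = 1 / Gamma (1 + \<alpha>)"
  by (simp add: coeff_a_def)

lemma sum_coeff_a: "(\<Sum>j<n. coeff_a \<alpha> j) = real n powr \<alpha> / Gamma (1 + \<alpha>)"
proof -
  have "(\<Sum>j<n. coeff_a \<alpha> j) = (\<Sum>j<n. real (Suc j) powr \<alpha> - real j powr \<alpha>) / Gamma (1 + \<alpha>)"
    by (simp add: coeff_a_def sum_divide_distrib add.commute)
  then show ?thesis by (subst (asm) sum_lessThan_telescope) simp
qed

lemma coarse_kernel_coeff_a:
  "coarse_kernel N (coeff_a \<alpha>) i = real N powr \<alpha> * coeff_a \<alpha> i"
proof -
  have "coarse_kernel N (coeff_a \<alpha>) i = (\<Sum>j<(i+1)*N. coeff_a \<alpha> j) - (\<Sum>j<i*N. coeff_a \<alpha> j)"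
    by (simp add: coarse_kernel_def lessThan_atLeast0 sum_diff_nat_ivl add.commute)
  also have "\<dots> = (real ((i + 1) * N) powr \<alpha> - real (i * N) powr \<alpha>) / Gamma (1 + \<alpha>)"
    by (simp only: sum_coeff_a diff_divide_distrib)
  also have "\<dots> = real N powr \<alpha> * coeff_a \<alpha> i"
    by (simp only: of_nat_mult powr_mult coeff_a_def of_nat_add of_nat_1) (simp add: algebra_simps)
  finally show ?thesis .
qed

text \<open>Cauchy's mean value theorem for \<open>s powr \<alpha>\<close> and its shift by one.\<close>

lemma coeff_a_Suc_obtain:
  assumes "0 < \<alpha>"
  obtains x where "real n < x" "x < real n + 1"
    "coeff_a \<alpha> (Suc n) = ((x + 1) / x) powr (\<alpha> - 1) * coeff_a \<alpha> n"
proof -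
  define A B where "A = (real n + 1) powr \<alpha> - real n powr \<alpha>"
    and "B = (real n + 2) powr \<alpha> - (real n + 1) powr \<alpha>"
  define H where "H s = B * s powr \<alpha> - A * (s + 1) powr \<alpha>" for s
  have H_deriv: "(H has_real_derivative \<alpha> * (B * s powr (\<alpha> - 1) - A * (s + 1) powr (\<alpha> - 1))) (at s)"
    if "0 < s" for s
    unfolding H_def[abs_def] using that
    by (auto intro!: derivative_eq_intros simp: algebra_simps)
  have "\<exists>z. real n < z \<and> z < real n + 1 \<and> DERIV H z :> 0"
  proof (rule Rolle)
    have "H (real n + 1) - H (real n) = B * A - A * B"
      unfolding A_def B_def H_def by (simp add: algebra_simps)
    then show "H (real n) = H (real n + 1)" by simp
    show "continuous_on {real n..real n + 1} H"
      unfolding H_def[abs_def] using assms by (intro continuous_intros continuous_on_powr') auto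
    show "H differentiable (at s)" if "real n < s" "s < real n + 1" for s
      using H_deriv[of s] that by (auto simp: real_differentiable_def)
  qed simp
  then obtain z where z: "real n < z" "z < real n + 1" "DERIV H z :> 0" by blast
  then have "B * z powr (\<alpha> - 1) = A * (z + 1) powr (\<alpha> - 1)"
    using DERIV_unique[OF z(3) H_deriv] assms by simp
  moreover have "0 < z" using z(1) by linarith
  ultimately have "B = ((z + 1) / z) powr (\<alpha> - 1) * A"
    by (simp add: powr_divide field_simps)
  then show thesis
    using z that by (simp add: coeff_a_def A_def B_def add.commute)
qed

lemma coeff_a_Suc_le:
  assumes "0 < \<alpha>" "\<alpha> \<le> 1"
  shows "coeff_a \<alpha> (Suc n) \<le> coeff_a \<alpha> n"
proof -
  obtain x where x: "real n < x" "coeff_a \<alpha> (Suc n) = ((x + 1) / x) powr (\<alpha> - 1) * coeff_a \<alpha> n"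
    using coeff_a_Suc_obtain[OF assms(1)] by blast
  have "((x + 1) / x) powr (\<alpha> - 1) \<le> ((x + 1) / x) powr 0"
    using assms x(1) by (intro powr_mono) (auto simp: divide_simps)
  then have "((x + 1) / x) powr (\<alpha> - 1) \<le> 1" using x(1) by simp
  then show ?thesis
    unfolding x(2) using coeff_a_pos[OF assms(1), of n] by (simp add: mult_le_cancel_right1)
qed

lemma log_convex_kernel_coeff_a:
  assumes "0 < \<alpha>" "\<alpha> \<le> 1"
  shows "log_convex_kernel (coeff_a \<alpha>)"
proof
  show "0 < coeff_a \<alpha> n" for n by (rule coeff_a_pos[OF assms(1)])
  fix n
  obtain x where x: "real n < x" "x < real n + 1"
    "coeff_a \<alpha> (Suc n) = ((x + 1) / x) powr (\<alpha> - 1) * coeff_a \<alpha> n"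
    by (rule coeff_a_Suc_obtain[OF assms(1)])
  obtain y where y: "real (Suc n) < y" "y < real (Suc n) + 1"
    "coeff_a \<alpha> (Suc (Suc n)) = ((y + 1) / y) powr (\<alpha> - 1) * coeff_a \<alpha> (Suc n)"
    by (rule coeff_a_Suc_obtain[OF assms(1)])
  have "(y + 1) / y \<le> (x + 1) / x" using x y by (simp add: field_simps)
  then have "((x + 1) / x) powr (\<alpha> - 1) \<le> ((y + 1) / y) powr (\<alpha> - 1)"
    using assms x y by (intro powr_mono2') auto
  then have "((x + 1) / x) powr (\<alpha> - 1) * (coeff_a \<alpha> n * coeff_a \<alpha> (Suc n))
      \<le> ((y + 1) / y) powr (\<alpha> - 1) * (coeff_a \<alpha> n * coeff_a \<alpha> (Suc n))"
    using coeff_a_pos[OF assms(1)] by (intro mult_right_mono) (simp_all add: less_imp_le)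
  then show "(coeff_a \<alpha> (Suc n))\<^sup>2 \<le> coeff_a \<alpha> n * coeff_a \<alpha> (Suc (Suc n))"
    using x(3) y(3) by (simp add: power2_eq_square mult_ac)
qed

lemma nonneg_volterra_kernel_coeff_a:
  assumes "0 < \<alpha>" "0 \<le> lam" "k powr \<alpha> * lam < coeff_c \<alpha> 0"
  shows "nonneg_volterra_kernel (coeff_a \<alpha>) (lam * k powr \<alpha>)"
proof
  show "0 \<le> coeff_a \<alpha> j" for j using coeff_a_pos[OF assms(1), of j] by simp
  show "lam * k powr \<alpha> * coeff_a \<alpha> 0 < 1"
    using assms Gamma_real_pos[of "1 + \<alpha>"] by (simp add: coeff_a_0 coeff_c_0 mult.commute)
qed (use assms in simp)

lemma powr_has_integral:
  fixes \<beta> x y :: real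
  assumes "0 < \<beta>" "0 \<le> x" "x \<le> y"
  shows "((\<lambda>s. s powr (\<beta> - 1)) has_integral (y powr \<beta> - x powr \<beta>) / \<beta>) {x..y}"
proof -
  have "((\<lambda>s. s powr (\<beta> - 1)) has_integral (y powr \<beta> / \<beta> - x powr \<beta> / \<beta>)) {x..y}"
  proof (rule fundamental_theorem_of_calculus_interior)
    show "continuous_on {x..y} (\<lambda>s. s powr \<beta> / \<beta>)"
      using assms by (intro continuous_intros continuous_on_powr') auto
    show "((\<lambda>s. s powr \<beta> / \<beta>) has_vector_derivative s powr (\<beta> - 1)) (at s)" if "s \<in> {x<..<y}" for s
      unfolding has_real_derivative_iff_has_vector_derivative[symmetric]
      using assms that by (auto intro!: derivative_eq_intros)
  qed (use assms in simp)
  then show ?thesis by (simp add: diff_divide_distrib)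
qed

lemma Gamma_plus1_pos: "Gamma (x + 1) = x * Gamma x" if "0 < x" for x :: real
  using that by (intro Gamma_plus1) (auto elim!: nonpos_Ints_cases)

lemma powr_grid_diff:
  assumes "0 < \<alpha>"
  shows "((real (Suc j) * k) powr \<alpha> - (real j * k) powr \<alpha>) / \<alpha> = Gamma \<alpha> * k powr \<alpha> * coeff_a \<alpha> j"
proof -
  have "Gamma (1 + \<alpha>) = \<alpha> * Gamma \<alpha>" "Gamma \<alpha> \<noteq> 0"
    using Gamma_plus1_pos[OF assms] Gamma_real_pos[OF assms] by (simp_all add: add.commute)
  moreover have "(real (Suc j) * k) powr \<alpha> - (real j * k) powr \<alpha>
      = k powr \<alpha> * ((real j + 1) powr \<alpha> - real j powr \<alpha>)"
    by (simp only: powr_mult of_nat_Suc) (simp add: algebra_simps)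
  ultimately show ?thesis using assms by (simp add: coeff_a_def)
qed

lemma integral_grid_sum:
  fixes f :: "real \<Rightarrow> real"
  assumes "0 \<le> k" "l \<le> n" "f integrable_on {real l * k..real n * k}"
  shows "(\<Sum>j=l..<n. integral {real j * k..real (Suc j) * k} f) = integral {real l * k..real n * k} f"
  using assms(2,3)
proof (induction rule: dec_induct)
  case (step n)
  have le: "real l * k \<le> real n * k" "real n * k \<le> real (Suc n) * k"
    using assms(1) step.hyps by (auto intro!: mult_right_mono)
  then have "integral {real l * k..real n * k} f + integral {real n * k..real (Suc n) * k} f
      = integral {real l * k..real (Suc n) * k} f"
    using step.prems by (intro Henstock_Kurzweil_Integration.integral_combine)
  moreover have "f integrable_on {real l * k..real n * k}"
    using le by (intro integrable_on_subinterval[OF step.prems]) auto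
  ultimately show ?case using step by simp
qed simp

text \<open>On a cell \<open>{j * x..(j + 1) * x}\<close> with \<open>j \<ge> 1\<close> the factor \<open>exp (- s)\<close> is at least
  \<open>exp (- 2 * j * x)\<close>; this fails for \<open>j = 0\<close>.\<close>

lemma exp_weighted_coeff_a_le_integral:
  assumes "0 < \<alpha>" "0 < x" "1 \<le> j"
    and integrable: "(\<lambda>s. s powr (\<alpha> - 1) / exp s) integrable_on {real j * x..real (Suc j) * x}"
  shows "Gamma \<alpha> * x powr \<alpha> * coeff_a \<alpha> j * exp (- 2 * x) ^ j
    \<le> integral {real j * x..real (Suc j) * x} (\<lambda>s. s powr (\<alpha> - 1) / exp s)"
proof (rule has_integral_le[OF _ integrable_integral[OF integrable]])
  have "((\<lambda>s. s powr (\<alpha> - 1)) has_integral Gamma \<alpha> * x powr \<alpha> * coeff_a \<alpha> j)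
      {real j * x..real (Suc j) * x}"
    unfolding powr_grid_diff[OF assms(1), symmetric]
    using assms by (intro powr_has_integral mult_right_mono) auto
  then show "((\<lambda>s. s powr (\<alpha> - 1) * exp (- 2 * x) ^ j) has_integral
      Gamma \<alpha> * x powr \<alpha> * coeff_a \<alpha> j * exp (- 2 * x) ^ j) {real j * x..real (Suc j) * x}"
    by (rule has_integral_mult_left)
  fix s assume "s \<in> {real j * x..real (Suc j) * x}"
  then have "s \<le> (real j + 1) * x" by (simp add: add.commute)
  also have "\<dots> \<le> (2 * real j) * x" using assms by (intro mult_right_mono) auto
  finally have "exp (- 2 * x) ^ j \<le> exp (- s)"
    by (simp add: exp_of_nat_mult[symmetric] mult_ac)
  then show "s powr (\<alpha> - 1) * exp (- 2 * x) ^ j \<le> s powr (\<alpha> - 1) / exp s"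
    unfolding exp_minus divide_inverse by (intro mult_left_mono) auto
qed

lemma exp_weighted_sum_coeff_a_le:
  assumes "0 < \<alpha>" "0 < x"
  shows "x powr \<alpha> * (\<Sum>j=1..n. coeff_a \<alpha> j * exp (- 2 * x) ^ j) \<le> 1"
proof -
  define f where "f s = s powr (\<alpha> - 1) / exp s" for s :: real
  have f_Gamma: "(f has_integral Gamma \<alpha>) {0..}"
    unfolding f_def[abs_def] by (rule Gamma_integral_real[OF assms(1)])
  have f_integrable: "f integrable_on {y..z}" if "0 \<le> y" for y z
    using integrable_on_subinterval[of f "{0..}"] f_Gamma that by (auto simp: integrable_on_def)
  have cell: "Gamma \<alpha> * x powr \<alpha> * coeff_a \<alpha> j * exp (- 2 * x) ^ j
      \<le> integral {real j * x..real (Suc j) * x} f" if "1 \<le> j" for j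
    using f_integrable[of "real j * x" "real (Suc j) * x"] assms that
    unfolding f_def[abs_def] by (intro exp_weighted_coeff_a_le_integral) auto
  have "Gamma \<alpha> * (x powr \<alpha> * (\<Sum>j=1..n. coeff_a \<alpha> j * exp (- 2 * x) ^ j))
      \<le> (\<Sum>j=1..<Suc n. integral {real j * x..real (Suc j) * x} f)"
    unfolding sum_distrib_left atLeastLessThanSuc_atLeastAtMost mult.assoc[symmetric]
    by (intro sum_mono cell) auto
  also have "\<dots> = integral {real 1 * x..real (Suc n) * x} f"
    using assms by (intro integral_grid_sum f_integrable) auto
  also have "\<dots> \<le> integral {0..} f"
    using f_Gamma assms by (intro integral_subset_le f_integrable) (auto simp: f_def integrable_on_def)
  also have "\<dots> = Gamma \<alpha>"
    using f_Gamma by (rule integral_unique)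
  finally show ?thesis
    using Gamma_real_pos[OF assms(1)] by (simp add: mult_le_cancel_left1)
qed

text \<open>With \<open>x = gronwall_rate \<alpha> lam * k / 2\<close> the weight \<open>x powr \<alpha>\<close> above is \<open>4 * lam * k powr \<alpha>\<close>.\<close>

definition gronwall_rate :: "real \<Rightarrow> real \<Rightarrow> real" where
  "gronwall_rate \<alpha> lam = 2 * (4 * lam) powr (1 / \<alpha>)"

lemma gronwall_rate_weighted_sum_le:
  assumes \<alpha>: "0 < \<alpha>" and lam: "0 \<le> lam" and k: "0 < k" "k powr \<alpha> * lam \<le> 1 / 2 * coeff_c \<alpha> 0"
  shows "lam * k powr \<alpha> * (\<Sum>j<n. coeff_a \<alpha> j * exp (- gronwall_rate \<alpha> lam * k) ^ j) \<le> 3 / 4"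
proof (cases "lam = 0 \<or> n = 0")
  case False
  then obtain l where n: "n = Suc l" by (cases n) auto
  have lam: "0 < lam" using False lam by simp
  define x where "x = (4 * lam) powr (1 / \<alpha>) * k"
  have x: "0 < x" using lam k by (simp add: x_def)
  have "x powr \<alpha> = 4 * (lam * k powr \<alpha>)"
    using \<alpha> lam k by (simp add: x_def powr_mult powr_powr)
  then have late: "4 * (lam * k powr \<alpha> * (\<Sum>j=1..l. coeff_a \<alpha> j * exp (- 2 * x) ^ j)) \<le> 1"
    using exp_weighted_sum_coeff_a_le[OF \<alpha> x, of l] by simp
  have first: "lam * k powr \<alpha> * coeff_a \<alpha> 0 \<le> 1 / 2"
    using k(2) \<alpha> Gamma_real_pos[of "1 + \<alpha>"] by (simp add: coeff_a_0 coeff_c_0 field_simps)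
  have "{..<n} = insert 0 {1..l}" using n by auto
  then have "lam * k powr \<alpha> * (\<Sum>j<n. coeff_a \<alpha> j * exp (- 2 * x) ^ j)
      = lam * k powr \<alpha> * coeff_a \<alpha> 0 + lam * k powr \<alpha> * (\<Sum>j=1..l. coeff_a \<alpha> j * exp (- 2 * x) ^ j)"
    by (simp add: distrib_left)
  also have "\<dots> \<le> 3 / 4" using late first by simp
  finally show ?thesis by (simp add: gronwall_rate_def x_def mult.assoc)
qed auto

lemma discrete_fractional_gronwall:
  assumes "0 < \<alpha>" "0 \<le> lam" "0 < k" "k powr \<alpha> * lam \<le> 1 / 2 * coeff_c \<alpha> 0"
    and "0 \<le> R"
    and "\<And>i. 1 \<le> i \<Longrightarrow> i \<le> N \<Longrightarrow> u i \<le> R + lam * k powr \<alpha> * volterra_conv (coeff_a \<alpha>) u i"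
    and "1 \<le> n" "n \<le> N"
  shows "u n \<le> 4 * R * exp (gronwall_rate \<alpha> lam * (real n * k))"
proof -
  let ?q = "exp (- gronwall_rate \<alpha> lam * k)"
  have "coeff_c \<alpha> 0 > 0" using assms(1) by (simp add: coeff_c_0)
  then interpret nonneg_volterra_kernel "coeff_a \<alpha>" "lam * k powr \<alpha>"
    using assms by (intro nonneg_volterra_kernel_coeff_a) auto
  have "u n \<le> R / (1 - 3 / 4) / ?q ^ n"
  proof (rule geometric_gronwall[OF _ _ gronwall_rate_weighted_sum_le[OF assms(1-4)]])
    show "?q \<le> 1" using assms(3) by (simp add: gronwall_rate_def)
  qed (use assms in auto)
  also have "?q ^ n = exp (- (gronwall_rate \<alpha> lam * (real n * k)))"
    by (simp add: exp_of_nat_mult[symmetric] mult_ac)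
  finally show ?thesis by (simp add: exp_minus inverse_eq_divide mult.commute[of R])
qed

section \<open>The implicit scheme\<close>

lemma conv_conv_inverse_eq_iff:
  assumes "p 0 \<noteq> 0"
  shows "conv (conv_inverse p) z = y \<longleftrightarrow> z = conv p y"
proof -
  have conv_eq_iff: "conv f g = h \<longleftrightarrow> Abs_fps f * Abs_fps g = Abs_fps h" for f g h
    by (auto simp: fun_eq_iff fps_eq_iff conv_eq_fps_mult)
  have inverse: "Abs_fps p * Abs_fps (conv_inverse p) = 1"
    using conv_inverse_eq_fps(2)[of p] assms by (auto simp: conv_eq_iff fps_eq_iff)
  have "conv (conv_inverse p) z = y \<longleftrightarrow> conv p y = z"
    unfolding conv_eq_iff
  proof
    assume "Abs_fps (conv_inverse p) * Abs_fps z = Abs_fps y"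
    then have "Abs_fps p * Abs_fps y = (Abs_fps p * Abs_fps (conv_inverse p)) * Abs_fps z"
      by (simp add: mult.assoc)
    then show "Abs_fps p * Abs_fps y = Abs_fps z" by (simp add: inverse)
  next
    assume "Abs_fps p * Abs_fps y = Abs_fps z"
    then have "Abs_fps (conv_inverse p) * Abs_fps z = (Abs_fps p * Abs_fps (conv_inverse p)) * Abs_fps y"
      by (metis mult.assoc mult.commute)
    then show "Abs_fps (conv_inverse p) * Abs_fps z = Abs_fps y" by (simp add: inverse)
  qed
  then show ?thesis by auto
qed

lemma discrete_caputo_eq_conv:
  assumes "1 \<le> n"
  shows "discrete_caputo \<alpha> k X n =
    k powr (- \<alpha>) * conv (conv_inverse (coeff_a \<alpha>)) (\<lambda>i. X i - X 0) n"
proof -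
  let ?q = "conv_inverse (coeff_a \<alpha>)"
  have "{0..n} = insert 0 (insert n {1..<n})" using assms by auto
  then have "conv ?q (\<lambda>i. X i - X 0) n = ?q 0 * (X n - X 0) + (\<Sum>i=1..<n. ?q i * (X (n - i) - X 0))"
    using assms by (simp add: conv_def)
  also have "\<dots> = ?q 0 * X n + (\<Sum>i=1..<n. ?q i * X (n - i)) - (?q 0 + (\<Sum>i=1..<n. ?q i)) * X 0"
    by (simp add: algebra_simps sum_subtractf sum_distrib_left)
  finally show ?thesis
    by (simp add: discrete_caputo_def coeff_c_init_def coeff_c_def sum_negf)
qed

lemma discrete_caputo_eq_iff_volterra:
  assumes "0 < \<alpha>" "0 < k"
  shows "(\<forall>n\<ge>1. discrete_caputo \<alpha> k X n = lam * X n) \<longleftrightarrow>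
    (\<forall>n\<ge>1. X n = X 0 + lam * k powr \<alpha> * volterra_conv (coeff_a \<alpha>) X n)"
proof -
  let ?q = "conv_inverse (coeff_a \<alpha>)"
  define z y where "z i = X i - X 0" and "y i = (if i = 0 then 0 else lam * k powr \<alpha> * X i)" for i
  have conv_y: "conv (coeff_a \<alpha>) y n = lam * k powr \<alpha> * volterra_conv (coeff_a \<alpha>) X n" for n
  proof -
    have "conv (coeff_a \<alpha>) y n = (\<Sum>j<n. coeff_a \<alpha> j * (lam * k powr \<alpha> * X (n - j)))"
      unfolding conv_def by (intro sum.mono_neutral_cong_right) (auto simp: y_def)
    then show ?thesis by (simp add: volterra_conv_reflect sum_distrib_left mult_ac)
  qed
  have "discrete_caputo \<alpha> k X n = lam * X n \<longleftrightarrow> conv ?q z n = y n" if "1 \<le> n" for n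
    using that \<open>0 < k\<close>
    by (simp add: discrete_caputo_eq_conv y_def z_def[abs_def] powr_minus field_simps)
  moreover have "conv ?q z 0 = y 0" by (simp add: conv_def y_def z_def)
  ultimately have "(\<forall>n\<ge>1. discrete_caputo \<alpha> k X n = lam * X n) \<longleftrightarrow> (\<forall>n. conv ?q z n = y n)"
    by (metis less_one linorder_not_le)
  also have "\<dots> \<longleftrightarrow> z = conv (coeff_a \<alpha>) y"
    using conv_conv_inverse_eq_iff[of "coeff_a \<alpha>"] coeff_a_pos[OF assms(1), of 0]
    by (simp add: fun_eq_iff)
  also have "\<dots> \<longleftrightarrow> (\<forall>n. X n = X 0 + lam * k powr \<alpha> * volterra_conv (coeff_a \<alpha>) X n)"
    by (simp only: fun_eq_iff conv_y z_def diff_eq_eq add.commute)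
  also have "\<dots> \<longleftrightarrow> (\<forall>n\<ge>1. X n = X 0 + lam * k powr \<alpha> * volterra_conv (coeff_a \<alpha>) X n)"
    by (metis add.right_neutral less_one linorder_not_le mult_zero_right volterra_conv_0)
  finally show ?thesis .
qed

lemma implicit_schemeD:
  assumes "0 < \<alpha>" "0 < k" "implicit_scheme \<alpha> lam k x0 X"
  shows "X n = x0 + lam * k powr \<alpha> * volterra_conv (coeff_a \<alpha>) X n"
  using assms(3) discrete_caputo_eq_iff_volterra[OF assms(1,2), of X lam]
  unfolding implicit_scheme_def by (cases "n = 0") auto

lemma implicit_scheme_incseq:
  assumes "0 < \<alpha>" "0 \<le> lam" "0 < k" "k powr \<alpha> * lam < coeff_c \<alpha> 0" "0 \<le> x0"
    and "implicit_scheme \<alpha> lam k x0 X"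
  shows "incseq X"
proof -
  interpret nonneg_volterra_kernel "coeff_a \<alpha>" "lam * k powr \<alpha>"
    using assms by (intro nonneg_volterra_kernel_coeff_a)
  show ?thesis using implicit_schemeD[of \<alpha> k lam x0 X] assms by (intro solution_incseq)
qed

lemma implicit_scheme_tendsto_0:
  assumes \<alpha>: "0 < \<alpha>" "\<alpha> \<le> 1" and "lam < 0" "0 < k" "0 \<le> x0" and X: "implicit_scheme \<alpha> lam k x0 X"
  shows "X \<longlonglongrightarrow> 0"
proof -
  interpret log_convex_kernel "coeff_a \<alpha>" by (rule log_convex_kernel_coeff_a[OF \<alpha>])
  show ?thesis
  proof (rule relaxation_tendsto_0)
    show "X n = x0 - (- lam * k powr \<alpha>) * volterra_conv (coeff_a \<alpha>) X n" for n
      using implicit_schemeD[OF \<alpha>(1) \<open>0 < k\<close> X, of n] by simp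
    have "filterlim (\<lambda>n. real n powr \<alpha>) at_top sequentially"
      by (rule filterlim_compose[OF real_powr_at_top[OF \<alpha>(1)] filterlim_real_sequentially])
    then show "filterlim (\<lambda>n. \<Sum>j<n. coeff_a \<alpha> j) at_top sequentially"
      unfolding sum_coeff_a divide_inverse using \<alpha>
      by (intro filterlim_at_top_mult_tendsto_pos[OF tendsto_const]) auto
  qed (use assms coeff_a_Suc_le in \<open>auto simp: mult_neg_pos\<close>)
qed

lemma implicit_scheme_refine_le:
  assumes \<alpha>: "0 < \<alpha>" and "0 \<le> lam" "0 < k" "0 < N" and "0 \<le> x0"
    and "(real N * k) powr \<alpha> * lam < coeff_c \<alpha> 0"
    and coarse: "implicit_scheme \<alpha> lam (real N * k) x0 Z" and fine: "implicit_scheme \<alpha> lam k x0 X"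
    and "m \<le> n * N"
  shows "X m \<le> Z n"
proof -
  have "k powr \<alpha> * lam \<le> (real N * k) powr \<alpha> * lam"
    using assms by (intro mult_right_mono powr_mono2) auto
  then interpret nonneg_volterra_kernel "coeff_a \<alpha>" "lam * k powr \<alpha>"
    using assms by (intro nonneg_volterra_kernel_coeff_a) auto
  have scale: "lam * k powr \<alpha> * volterra_conv (coarse_kernel N (coeff_a \<alpha>)) u l
      = lam * (real N * k) powr \<alpha> * volterra_conv (coeff_a \<alpha>) u l" for u l
    using \<open>0 < k\<close> by (simp add: coarse_kernel_coeff_a volterra_conv_def powr_mult sum_distrib_left mult_ac)
  interpret coarse: nonneg_volterra_kernel "coeff_a \<alpha>" "lam * (real N * k) powr \<alpha>"
    using assms by (intro nonneg_volterra_kernel_coeff_a)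
  have "nonneg_volterra_kernel (coarse_kernel N (coeff_a \<alpha>)) (lam * k powr \<alpha>)"
  proof
    have "lam * k powr \<alpha> * coarse_kernel N (coeff_a \<alpha>) 0 = lam * (real N * k) powr \<alpha> * coeff_a \<alpha> 0"
      using scale[of "\<lambda>_. 1" 1] by (simp add: volterra_conv_def)
    also have "\<dots> < 1" by (rule coarse.implicit_factor_less_1)
    finally show "lam * k powr \<alpha> * coarse_kernel N (coeff_a \<alpha>) 0 < 1" .
  qed (auto simp: coarse_kernel_def intro!: sum_nonneg kernel_nonneg factor_nonneg)
  then show ?thesis
  proof (rule solution_le_coarse_solution[OF \<open>0 < N\<close>])
    show "X i = x0 + lam * k powr \<alpha> * volterra_conv (coeff_a \<alpha>) X i" for i
      by (rule implicit_schemeD[OF \<alpha> \<open>0 < k\<close> fine])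
    show "Z i = x0 + lam * k powr \<alpha> * volterra_conv (coarse_kernel N (coeff_a \<alpha>)) Z i" for i
      unfolding scale using \<open>0 < k\<close> \<open>0 < N\<close> by (intro implicit_schemeD[OF \<alpha> _ coarse]) simp
  qed (use assms in auto)
qed

lemma pw_const_eq_ceiling:
  assumes "0 < k" "0 < t"
  shows "pw_const k X t = X (nat \<lceil>t / k\<rceil>)"
proof (rule pw_const_eq)
  have pos: "0 < \<lceil>t / k\<rceil>" using assms by simp
  then show "1 \<le> nat \<lceil>t / k\<rceil>" by linarith
  show "t \<in> {(real (nat \<lceil>t / k\<rceil>) - 1) * k<..real (nat \<lceil>t / k\<rceil>) * k}"
    using pos ceiling_divide_lower[OF assms(1), of t] ceiling_divide_upper[OF assms(1), of t] by simp
qed (use assms in simp)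

lemma pw_const_refine_le:
  assumes "0 < \<alpha>" "0 \<le> lam" "0 < k" "0 < N" "0 \<le> x0"
    and "(real N * k) powr \<alpha> * lam < coeff_c \<alpha> 0"
    and "implicit_scheme \<alpha> lam (real N * k) x0 Z" "implicit_scheme \<alpha> lam k x0 X" and "0 < t"
  shows "pw_const k X t \<le> pw_const (real N * k) Z t"
proof -
  define n where "n = nat \<lceil>t / (real N * k)\<rceil>"
  have "t \<le> of_int \<lceil>t / (real N * k)\<rceil> * (real N * k)"
    using assms by (intro ceiling_divide_upper) simp
  then have "t / k \<le> real (n * N)"
    using assms by (simp add: n_def field_simps)
  then have "nat \<lceil>t / k\<rceil> \<le> n * N"
    by (simp add: nat_le_iff ceiling_le_iff)
  then have "X (nat \<lceil>t / k\<rceil>) \<le> Z n"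
    using assms by (intro implicit_scheme_refine_le[of \<alpha> lam k N x0 Z X])
  then show ?thesis
    using assms by (simp add: pw_const_eq_ceiling n_def)
qed

lemma implicit_scheme_le:
  assumes \<alpha>: "0 < \<alpha>" and "0 \<le> lam" and k: "0 < k" "k powr \<alpha> * lam \<le> 1 / 2 * coeff_c \<alpha> 0"
    and "0 \<le> x0" and X: "implicit_scheme \<alpha> lam k x0 X"
  shows "X n \<le> 4 * x0 * exp (gronwall_rate \<alpha> lam * (real n * k))"
proof (cases n)
  case 0
  then show ?thesis using implicit_schemeD[OF \<alpha> k(1) X, of 0] \<open>0 \<le> x0\<close> by simp
next
  case (Suc l)
  then show ?thesis
    using assms eq_refl[OF implicit_schemeD[OF \<alpha> k(1) X]]
    by (intro discrete_fractional_gronwall[of _ _ _ _ n]) simp_all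
qed

section \<open>Riemann-Liouville integrals\<close>

definition rl_integral :: "real \<Rightarrow> (real \<Rightarrow> real) \<Rightarrow> real \<Rightarrow> real" where
  "rl_integral \<beta> f t = 1 / Gamma \<beta> * integral {0..t} (\<lambda>s. (t - s) powr (\<beta> - 1) * f s)"

lemma rl_integral_cmult: "rl_integral \<beta> (\<lambda>s. c * f s) t = c * rl_integral \<beta> f t"
proof -
  have "integral {0..t} (\<lambda>s. (t - s) powr (\<beta> - 1) * (c * f s))
      = integral {0..t} (\<lambda>s. c * ((t - s) powr (\<beta> - 1) * f s))"
    by (simp add: mult.left_commute)
  then show ?thesis by (simp add: rl_integral_def)
qed

lemma rl_integral_spike:
  assumes "negligible N" "\<And>s. s \<in> {0..t} - N \<Longrightarrow> f s = g s"
  shows "rl_integral \<beta> f t = rl_integral \<beta> g t"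
  unfolding rl_integral_def
  by (intro arg_cong2[where f = "(*)"] refl integral_spike[OF assms(1)]) (simp add: assms(2))

lemma rl_kernel_has_integral:
  fixes \<beta> t x y :: real
  assumes "0 < \<beta>" "x \<le> y" "y \<le> t"
  shows "((\<lambda>s. (t - s) powr (\<beta> - 1)) has_integral ((t - x) powr \<beta> - (t - y) powr \<beta>) / \<beta>) {x..y}"
proof -
  have "(\<lambda>s. t - s) ` {t - y..t - x} = {x..y}"
    by (auto simp: image_def algebra_simps intro: bexI[of _ "t - _"])
  then show ?thesis
    using has_integral_affinity[of "\<lambda>s. s powr (\<beta> - 1)" _ "t - y" "t - x" "-1" t]
      powr_has_integral[of \<beta> "t - y" "t - x"] assms
    by simp
qed

lemma rl_kernel_mult_absolutely_integrable:
  fixes f :: "real \<Rightarrow> real"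
  assumes "0 < \<beta>" "0 \<le> t" "continuous_on {0..t} f"
  shows "(\<lambda>s. (t - s) powr (\<beta> - 1) * f s) absolutely_integrable_on {0..t}"
proof -
  have "(\<lambda>s. f s * (t - s) powr (\<beta> - 1)) absolutely_integrable_on {0..t}"
  proof (rule absolutely_integrable_bounded_measurable_product_real)
    show "f \<in> borel_measurable (lebesgue_on {0..t})"
      using assms by (intro continuous_imp_measurable_on_sets_lebesgue) auto
    show "bounded (f ` {0..t})"
      using assms by (intro compact_imp_bounded compact_continuous_image) auto
    show "(\<lambda>s. (t - s) powr (\<beta> - 1)) absolutely_integrable_on {0..t}"
      using rl_kernel_has_integral[of \<beta> 0 t t] assms
      by (intro nonnegative_absolutely_integrable_1) (auto simp: integrable_on_def)
  qed simp
  then show ?thesis by (simp add: mult.commute)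
qed

lemma rl_integral_diff:
  assumes "0 < \<beta>" "0 \<le> t" "continuous_on {0..t} f" "continuous_on {0..t} g"
  shows "rl_integral \<beta> (\<lambda>s. f s - g s) t = rl_integral \<beta> f t - rl_integral \<beta> g t"
  using assms unfolding rl_integral_def right_diff_distrib
  by (subst Henstock_Kurzweil_Integration.integral_diff)
    (auto intro!: set_lebesgue_integral_eq_integral(1) rl_kernel_mult_absolutely_integrable
      simp: right_diff_distrib)

lemma Beta_kernel_has_integral:
  fixes a b s t :: real
  assumes "0 < a" "0 < b" "s < t"
  shows "((\<lambda>u. (t - u) powr (a - 1) * (u - s) powr (b - 1)) has_integral
    Beta a b * (t - s) powr (a + b - 1)) {s..t}"
proof -
  define d where "d = t - s"
  have d: "0 < d" using assms by (simp add: d_def)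
  have image: "(\<lambda>x. d * x + s) ` {0..1} = {s..t}"
    using d by (simp add: image_affinity_atLeastAtMost d_def)
  have "((\<lambda>x. x powr (b - 1) * (1 - x) powr (a - 1)) has_integral Beta b a) (cbox 0 1)"
    using has_integral_Beta_real[OF assms(2,1)] by simp
  from has_integral_affinity[OF this, of "1 / d" "- s / d"] d
  have "((\<lambda>u. (u / d - s / d) powr (b - 1) * (1 - (u / d - s / d)) powr (a - 1)) has_integral d * Beta b a) {s..t}"
    by (simp add: image)
  from has_integral_mult_right[OF this, of "d powr (a + b - 2)"]
  have "((\<lambda>u. d powr (a + b - 2) * ((u / d - s / d) powr (b - 1) * (1 - (u / d - s / d)) powr (a - 1)))
      has_integral d powr (a + b - 2) * d * Beta b a) {s..t}"
    by (simp add: mult.assoc)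
  also have "d powr (a + b - 2) * d = d powr (a + b - 1)"
    using d powr_add[of d "a + b - 2" 1] by simp
  finally have scaled: "((\<lambda>u. d powr (a + b - 2) * ((u / d - s / d) powr (b - 1) * (1 - (u / d - s / d)) powr (a - 1)))
      has_integral Beta a b * (t - s) powr (a + b - 1)) {s..t}"
    by (simp add: d_def Beta_commute mult.commute)
  show ?thesis
  proof (rule has_integral_eq[OF _ scaled])
    fix u assume u: "u \<in> {s..t}"
    have "u / d - s / d = (u - s) / d" "1 - (u / d - s / d) = (t - u) / d"
      using d by (simp_all add: field_simps) (simp add: d_def)
    moreover have "d powr (a + b - 2) = d powr (b - 1) * d powr (a - 1)"
      by (simp add: powr_add[symmetric] add.commute)
    ultimately show "d powr (a + b - 2) * ((u / d - s / d) powr (b - 1) * (1 - (u / d - s / d)) powr (a - 1))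
        = (t - u) powr (a - 1) * (u - s) powr (b - 1)"
      using u d by (simp add: powr_divide)
  qed
qed

lemma absolutely_integrable_imp_lborel:
  fixes f :: "real \<Rightarrow> real"
  assumes f: "f absolutely_integrable_on S" and [measurable]: "f \<in> borel_measurable borel" "S \<in> sets borel"
  shows "integrable lborel (\<lambda>x. indicator S x * f x)"
    and "(\<integral>x. indicator S x * f x \<partial>lborel) = integral S f"
proof -
  have m: "(\<lambda>x. indicator S x * f x) \<in> borel_measurable lborel" by measurable
  show "integrable lborel (\<lambda>x. indicator S x * f x)"
    using f integrable_completion[OF m] by (simp add: set_integrable_def)
  show "(\<integral>x. indicator S x * f x \<partial>lborel) = integral S f"
    using set_lebesgue_integral_eq_integral(2)[OF f] integral_completion[OF m]
    by (simp add: set_lebesgue_integral_def)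
qed

lemma Beta_kernel_lborel:
  fixes a b s t :: real
  assumes "0 < a" "0 < b" "s < t"
  shows "integrable lborel (\<lambda>u. indicator {s..t} u * ((t - u) powr (a - 1) * (u - s) powr (b - 1)))"
    and "(\<integral>u. indicator {s..t} u * ((t - u) powr (a - 1) * (u - s) powr (b - 1)) \<partial>lborel) =
      Beta a b * (t - s) powr (a + b - 1)"
proof -
  note Beta = Beta_kernel_has_integral[OF assms]
  have "(\<lambda>u. (t - u) powr (a - 1) * (u - s) powr (b - 1)) absolutely_integrable_on {s..t}"
    using Beta by (intro nonnegative_absolutely_integrable_1) (auto simp: integrable_on_def)
  from absolutely_integrable_imp_lborel[OF this]
  show "integrable lborel (\<lambda>u. indicator {s..t} u * ((t - u) powr (a - 1) * (u - s) powr (b - 1)))"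
    and "(\<integral>u. indicator {s..t} u * ((t - u) powr (a - 1) * (u - s) powr (b - 1)) \<partial>lborel) =
      Beta a b * (t - s) powr (a + b - 1)"
    using integral_unique[OF Beta] by auto
qed

definition rl_triangle_kernel :: "real \<Rightarrow> real \<Rightarrow> real \<Rightarrow> (real \<Rightarrow> real) \<Rightarrow> real \<Rightarrow> real \<Rightarrow> real" where
  "rl_triangle_kernel \<alpha> \<beta> t f s u =
     indicator {0..t} s * f s * (indicator {s..t} u * ((t - u) powr (\<alpha> - 1) * (u - s) powr (\<beta> - 1)))"

lemma measurable_rl_triangle_kernel [measurable]:
  assumes [measurable]: "f \<in> borel_measurable borel"
  shows "case_prod (rl_triangle_kernel \<alpha> \<beta> t f) \<in> borel_measurable (lborel \<Otimes>\<^sub>M lborel)"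
proof -
  have "case_prod (rl_triangle_kernel \<alpha> \<beta> t f) = (\<lambda>(s, u). if 0 \<le> s \<and> s \<le> u \<and> u \<le> t
      then f s * ((t - u) powr (\<alpha> - 1) * (u - s) powr (\<beta> - 1)) else 0)"
    by (auto simp: fun_eq_iff rl_triangle_kernel_def indicator_def)
  then show ?thesis by simp
qed

lemma
  assumes "0 < \<alpha>" "0 < \<beta>" "s \<noteq> t"
  shows integrable_rl_triangle_kernel: "integrable lborel (rl_triangle_kernel \<alpha> \<beta> t f s)"
    and integral_rl_triangle_kernel: "(\<integral>u. rl_triangle_kernel \<alpha> \<beta> t f s u \<partial>lborel) =
      Beta \<alpha> \<beta> * (indicator {0..t} s * ((t - s) powr (\<alpha> + \<beta> - 1) * f s))"
    and integral_norm_rl_triangle_kernel: "(\<integral>u. norm (rl_triangle_kernel \<alpha> \<beta> t f s u) \<partial>lborel) =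
      Beta \<alpha> \<beta> * norm (indicator {0..t} s * ((t - s) powr (\<alpha> + \<beta> - 1) * f s))"
proof -
  have norm_eq: "norm (rl_triangle_kernel \<alpha> \<beta> t f s u) = \<bar>indicator {0..t} s * f s\<bar> *
      (indicator {s..t} u * ((t - u) powr (\<alpha> - 1) * (u - s) powr (\<beta> - 1)))" for u
    by (simp add: rl_triangle_kernel_def abs_mult)
  show "integrable lborel (rl_triangle_kernel \<alpha> \<beta> t f s)"
    "(\<integral>u. rl_triangle_kernel \<alpha> \<beta> t f s u \<partial>lborel) =
      Beta \<alpha> \<beta> * (indicator {0..t} s * ((t - s) powr (\<alpha> + \<beta> - 1) * f s))"
    "(\<integral>u. norm (rl_triangle_kernel \<alpha> \<beta> t f s u) \<partial>lborel) =
      Beta \<alpha> \<beta> * norm (indicator {0..t} s * ((t - s) powr (\<alpha> + \<beta> - 1) * f s))"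
    unfolding norm_eq using assms Beta_kernel_lborel[of \<alpha> \<beta> s t]
    by (cases "s < t"; simp add: rl_triangle_kernel_def[abs_def] abs_mult)+
qed

lemma integrable_pair_rl_triangle_kernel:
  assumes "0 < \<alpha>" "0 < \<beta>" and f [measurable]: "f \<in> borel_measurable borel"
    and "(\<lambda>s. (t - s) powr (\<alpha> + \<beta> - 1) * f s) absolutely_integrable_on {0..t}"
  shows "integrable (lborel \<Otimes>\<^sub>M lborel) (case_prod (rl_triangle_kernel \<alpha> \<beta> t f))"
proof (rule lborel_pair.Fubini_integrable[OF measurable_rl_triangle_kernel[OF f]])
  have off_t: "AE s in lborel. s \<noteq> t" by (rule AE_lborel_singleton)
  then show "AE s in lborel. integrable lborel (\<lambda>u. case_prod (rl_triangle_kernel \<alpha> \<beta> t f) (s, u))"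
    by eventually_elim (simp add: integrable_rl_triangle_kernel[OF assms(1,2)])
  have "integrable lborel (\<lambda>s. Beta \<alpha> \<beta> * norm (indicator {0..t} s * ((t - s) powr (\<alpha> + \<beta> - 1) * f s)))"
    by (intro integrable_mult_right integrable_norm absolutely_integrable_imp_lborel(1)[OF assms(4)]) auto
  then show "integrable lborel (\<lambda>s. \<integral>u. norm (case_prod (rl_triangle_kernel \<alpha> \<beta> t f) (s, u)) \<partial>lborel)"
  proof (rule integrable_cong_AE_imp)
    show "AE s in lborel. Beta \<alpha> \<beta> * norm (indicator {0..t} s * ((t - s) powr (\<alpha> + \<beta> - 1) * f s)) =
        (\<integral>u. norm (case_prod (rl_triangle_kernel \<alpha> \<beta> t f) (s, u)) \<partial>lborel)"
      using off_t unfolding prod.case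
      by eventually_elim (rule integral_norm_rl_triangle_kernel[OF assms(1,2), symmetric])
  qed measurable
qed

lemma integral_rl_triangle_kernel_snd:
  assumes "0 < \<beta>" and integrable: "integrable lborel (\<lambda>s. rl_triangle_kernel \<alpha> \<beta> t f s u)" and "u \<noteq> t"
  shows "(\<integral>s. rl_triangle_kernel \<alpha> \<beta> t f s u \<partial>lborel) =
    (if u \<in> {0..t} then Gamma \<beta> * ((t - u) powr (\<alpha> - 1) * rl_integral \<beta> f u) else 0)"
proof (cases "u \<in> {0..t}")
  case True
  define g where "g s = indicator {0..u} s * ((u - s) powr (\<beta> - 1) * f s)" for s
  have H_eq: "rl_triangle_kernel \<alpha> \<beta> t f s u = (t - u) powr (\<alpha> - 1) * g s" for s
    using True by (auto simp: rl_triangle_kernel_def g_def indicator_def)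
  have "integrable lborel (\<lambda>s. inverse ((t - u) powr (\<alpha> - 1)) * rl_triangle_kernel \<alpha> \<beta> t f s u)"
    by (rule integrable_mult_right[OF integrable])
  then have "integrable lborel g"
    using True \<open>u \<noteq> t\<close> by (simp add: H_eq mult.assoc[symmetric])
  then have "(\<integral>s. g s \<partial>lborel) = integral UNIV g" by (rule integral_lborel[symmetric])
  also have "\<dots> = integral {0..u} (\<lambda>s. (u - s) powr (\<beta> - 1) * f s)"
    unfolding integral_restrict_UNIV[of "{0..u}", symmetric]
    by (intro integral_cong) (simp add: g_def)
  also have "\<dots> = Gamma \<beta> * rl_integral \<beta> f u"
    using Gamma_real_pos[OF assms(1)] by (simp add: rl_integral_def)
  finally show ?thesis using True by (simp add: H_eq)
next
  case False
  then have "rl_triangle_kernel \<alpha> \<beta> t f s u = 0" for s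
    by (auto simp: rl_triangle_kernel_def indicator_def)
  then show ?thesis using False by auto
qed

text \<open>Fubini on the triangle \<open>0 \<le> s \<le> u \<le> t\<close>.\<close>

lemma rl_integral_compose_borel:
  assumes pos: "0 < \<alpha>" "0 < \<beta>" and f [measurable]: "f \<in> borel_measurable borel"
    and abs_int: "(\<lambda>s. (t - s) powr (\<alpha> + \<beta> - 1) * f s) absolutely_integrable_on {0..t}"
  shows "rl_integral \<alpha> (rl_integral \<beta> f) t = rl_integral (\<alpha> + \<beta>) f t"
proof -
  let ?H = "rl_triangle_kernel \<alpha> \<beta> t f"
  let ?I = "Gamma \<alpha> * Gamma \<beta> * rl_integral (\<alpha> + \<beta>) f t"
  note H_integrable = integrable_pair_rl_triangle_kernel[OF pos f abs_int]
  have "(\<integral>u. (\<integral>s. ?H s u \<partial>lborel) \<partial>lborel) = (\<integral>s. (\<integral>u. ?H s u \<partial>lborel) \<partial>lborel)"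
    by (rule lborel_pair.Fubini_integral[OF H_integrable])
  also have "\<dots> = (\<integral>s. Beta \<alpha> \<beta> * (indicator {0..t} s * ((t - s) powr (\<alpha> + \<beta> - 1) * f s)) \<partial>lborel)"
  proof (rule integral_cong_AE)
    show "(\<lambda>s. \<integral>u. ?H s u \<partial>lborel) \<in> borel_measurable lborel"
      using borel_measurable_integrable[OF lborel_pair.integrable_fst[OF H_integrable]] .
    show "AE s in lborel. (\<integral>u. ?H s u \<partial>lborel) =
        Beta \<alpha> \<beta> * (indicator {0..t} s * ((t - s) powr (\<alpha> + \<beta> - 1) * f s))"
      using AE_lborel_singleton[of t] by eventually_elim (rule integral_rl_triangle_kernel[OF pos])
  qed measurable
  also have "\<dots> = ?I"
    using absolutely_integrable_imp_lborel(2)[OF abs_int] by (simp add: Beta_def rl_integral_def)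
  finally have "((\<lambda>u. \<integral>s. ?H s u \<partial>lborel) has_integral ?I) UNIV"
    using has_integral_integral_lborel[OF lborel_pair.integrable_snd[OF H_integrable]] by simp
  moreover have "AE u in lborel. (\<integral>s. ?H s u \<partial>lborel) =
      (if u \<in> {0..t} then Gamma \<beta> * ((t - u) powr (\<alpha> - 1) * rl_integral \<beta> f u) else 0)"
    using lborel_pair.AE_integrable_snd[OF H_integrable] AE_lborel_singleton[of t]
    by eventually_elim (rule integral_rl_triangle_kernel_snd[OF pos(2)])
  ultimately have "((\<lambda>u. if u \<in> {0..t} then Gamma \<beta> * ((t - u) powr (\<alpha> - 1) * rl_integral \<beta> f u) else 0)
      has_integral ?I) UNIV"
    by (subst has_integral_AE[symmetric]) auto
  then have "((\<lambda>u. Gamma \<beta> * ((t - u) powr (\<alpha> - 1) * rl_integral \<beta> f u)) has_integral ?I) {0..t}"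
    by (simp only: has_integral_restrict_UNIV)
  from integral_unique[OF this]
  have "Gamma \<beta> * integral {0..t} (\<lambda>u. (t - u) powr (\<alpha> - 1) * rl_integral \<beta> f u) = ?I" by simp
  then show ?thesis
    using Gamma_real_pos[OF pos(1)] Gamma_real_pos[OF pos(2)]
    by (simp add: rl_integral_def[of \<alpha> "rl_integral \<beta> f"] field_simps)
qed

lemma absolutely_integrable_borel_version:
  fixes f :: "real \<Rightarrow> real"
  assumes "f absolutely_integrable_on S"
  obtains g N where "g \<in> borel_measurable borel" "negligible N" "\<And>s. s \<in> S - N \<Longrightarrow> f s = g s"
proof -
  have "(\<lambda>s. indicator S s *\<^sub>R f s) \<in> borel_measurable (completion lborel)"
    using assms by (simp add: set_integrable_def)
  then obtain g where g: "g \<in> borel_measurable lborel" "AE s in lborel. indicator S s *\<^sub>R f s = g s"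
    using completion_ex_borel_measurable_real by blast
  then obtain N where N: "N \<in> null_sets lborel" "{s. indicator S s *\<^sub>R f s \<noteq> g s} \<subseteq> N"
    by (auto simp: eventually_ae_filter)
  show thesis
  proof
    show "g \<in> borel_measurable borel" using g(1) by simp
    show "negligible N" using N(1) by (simp add: negligible_iff_null_sets null_sets_completionI)
    show "f s = g s" if "s \<in> S - N" for s
    proof -
      have "indicator S s *\<^sub>R f s = g s" using N(2) that by blast
      then show ?thesis using that by simp
    qed
  qed
qed

lemma rl_integral_compose:
  assumes pos: "0 < \<alpha>" "0 < \<beta>"
    and abs_int: "(\<lambda>s. (t - s) powr (\<alpha> + \<beta> - 1) * f s) absolutely_integrable_on {0..t}"
  shows "rl_integral \<alpha> (rl_integral \<beta> f) t = rl_integral (\<alpha> + \<beta>) f t"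
proof -
  obtain g N where g [measurable]: "g \<in> borel_measurable borel" and N: "negligible N"
    "\<And>s. s \<in> {0..t} - N \<Longrightarrow> (t - s) powr (\<alpha> + \<beta> - 1) * f s = g s"
    using absolutely_integrable_borel_version[OF abs_int] by metis
  define f' where "f' s = g s / (t - s) powr (\<alpha> + \<beta> - 1)" for s
  have f'_eq: "f s = f' s" if "s \<in> {0..t} - insert t N" for s
    using N(2)[of s] that by (auto simp: f'_def field_simps)
  have N': "negligible (insert t N)" using N(1) by simp
  have rl_eq: "rl_integral \<gamma> f u = rl_integral \<gamma> f' u" if "u \<le> t" for \<gamma> u
    using that f'_eq by (intro rl_integral_spike[OF N']) auto
  have "rl_integral \<alpha> (rl_integral \<beta> f) t = rl_integral \<alpha> (rl_integral \<beta> f') t"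
    by (rule rl_integral_spike[of "{}"]) (auto simp: rl_eq)
  also have "\<dots> = rl_integral (\<alpha> + \<beta>) f' t"
  proof (rule rl_integral_compose_borel[OF pos])
    show "f' \<in> borel_measurable borel" unfolding f'_def[abs_def] by measurable
    show "(\<lambda>s. (t - s) powr (\<alpha> + \<beta> - 1) * f' s) absolutely_integrable_on {0..t}"
      by (rule absolutely_integrable_spike[OF abs_int N']) (use f'_eq in auto)
  qed
  finally show ?thesis by (simp add: rl_eq)
qed

section \<open>Mittag-Leffler functions\<close>

lemma Gamma_add_ge:
  fixes x \<alpha> :: real
  assumes "1 < x" "0 < \<alpha>"
  shows "(x - 1) powr \<alpha> * Gamma x \<le> Gamma (x + \<alpha>)"
proof -
  have pos: "0 < Gamma (x - 1)" "0 < Gamma x" "0 < Gamma (x + \<alpha>)"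
    using assms by auto
  have "Gamma x = (x - 1) * Gamma (x - 1)"
    using Gamma_plus1_pos[of "x - 1"] assms by simp
  then have step: "ln (Gamma x) - ln (Gamma (x - 1)) = ln (x - 1)"
    using assms pos(1)[THEN less_imp_neq] by (simp add: ln_mult)
  have "(ln (Gamma (x - 1)) - ln (Gamma x)) / (x - 1 - x) \<le> (ln (Gamma x) - ln (Gamma (x + \<alpha>))) / (x - (x + \<alpha>))"
    using convex_on_slope_le[OF log_convex_Gamma_real, of "x - 1" "x + \<alpha>" x] assms by simp
  then have "\<alpha> * ln (x - 1) + ln (Gamma x) \<le> ln (Gamma (x + \<alpha>))"
    using assms step by (simp add: field_simps)
  then have "ln ((x - 1) powr \<alpha> * Gamma x) \<le> ln (Gamma (x + \<alpha>))"
    using assms pos(2)[THEN less_imp_neq] by (simp add: ln_mult ln_powr)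
  then show ?thesis using assms pos by (subst (asm) ln_le_cancel_iff) auto
qed

definition mittag_leffler2 :: "real \<Rightarrow> real \<Rightarrow> real \<Rightarrow> real" where
  "mittag_leffler2 \<alpha> \<beta> z = (\<Sum>n. z ^ n / Gamma (real n * \<alpha> + \<beta>))"

lemma mittag_leffler_eq_mittag_leffler2: "mittag_leffler \<alpha> = mittag_leffler2 \<alpha> 1"
  by (simp add: fun_eq_iff mittag_leffler_def mittag_leffler2_def)

lemma summable_mittag_leffler2:
  fixes \<alpha> \<beta> z :: real
  assumes "0 < \<alpha>"
  shows "summable (\<lambda>n. z ^ n / Gamma (real n * \<alpha> + \<beta>))"
proof -
  have "filterlim (\<lambda>n. (real n * \<alpha> + \<beta> - 1) powr \<alpha>) at_top sequentially"
    "filterlim (\<lambda>n. real n * \<alpha> + \<beta> - 1) at_top sequentially"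
    using assms by real_asymp+
  then have "\<forall>\<^sub>F n in sequentially. 2 * \<bar>z\<bar> < (real n * \<alpha> + \<beta> - 1) powr \<alpha> \<and> 0 < real n * \<alpha> + \<beta> - 1"
    unfolding filterlim_at_top_dense by (intro eventually_conj) blast+
  then obtain N where N: "\<And>n. N \<le> n \<Longrightarrow>
      2 * \<bar>z\<bar> < (real n * \<alpha> + \<beta> - 1) powr \<alpha> \<and> 0 < real n * \<alpha> + \<beta> - 1"
    by (auto simp: eventually_sequentially)
  show ?thesis
  proof (rule summable_ratio_test[of "1 / 2" N])
    fix n assume "N \<le> n"
    define x where "x = real n * \<alpha> + \<beta>"
    have x: "1 < x" "2 * \<bar>z\<bar> < (x - 1) powr \<alpha>" using N[OF \<open>N \<le> n\<close>] by (auto simp: x_def)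
    have pos: "0 < Gamma x" "0 < Gamma (x + \<alpha>)" using x assms by auto
    have "2 * \<bar>z\<bar> * Gamma x \<le> (x - 1) powr \<alpha> * Gamma x"
      using x pos by (intro mult_right_mono) auto
    also have "\<dots> \<le> Gamma (x + \<alpha>)" by (rule Gamma_add_ge[OF x(1) assms])
    finally have "\<bar>z\<bar> / Gamma (x + \<alpha>) \<le> 1 / 2 / Gamma x"
      using pos by (simp add: field_simps)
    from mult_left_mono[OF this, of "\<bar>z\<bar> ^ n"]
    have "\<bar>z\<bar> ^ Suc n / Gamma (x + \<alpha>) \<le> 1 / 2 * (\<bar>z\<bar> ^ n / Gamma x)" by (simp add: mult_ac)
    moreover have "real (Suc n) * \<alpha> + \<beta> = x + \<alpha>" by (simp add: x_def algebra_simps)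
    ultimately show "norm (z ^ Suc n / Gamma (real (Suc n) * \<alpha> + \<beta>)) \<le>
        1 / 2 * norm (z ^ n / Gamma (real n * \<alpha> + \<beta>))"
      using pos by (simp add: x_def[symmetric] abs_mult power_abs)
  qed simp
qed

lemma mittag_leffler2_mono:
  assumes "0 < \<alpha>" "0 < \<beta>" "0 \<le> x" "x \<le> y"
  shows "mittag_leffler2 \<alpha> \<beta> x \<le> mittag_leffler2 \<alpha> \<beta> y"
  unfolding mittag_leffler2_def using assms
  by (intro suminf_le divide_right_mono power_mono summable_mittag_leffler2)
    (auto simp: less_imp_le add_nonneg_pos)

lemma mittag_leffler2_powser_has_derivative:
  assumes "0 < \<alpha>"
  shows "(mittag_leffler2 \<alpha> \<beta> has_real_derivative
    (\<Sum>n. diffs (\<lambda>n. 1 / Gamma (real n * \<alpha> + \<beta>)) n * z ^ n)) (at z)"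
proof -
  have "mittag_leffler2 \<alpha> \<beta> = (\<lambda>z. \<Sum>n. 1 / Gamma (real n * \<alpha> + \<beta>) * z ^ n)"
    by (simp add: fun_eq_iff mittag_leffler2_def)
  moreover have "summable (\<lambda>n. 1 / Gamma (real n * \<alpha> + \<beta>) * y ^ n)" for y
    using summable_mittag_leffler2[OF assms, of y \<beta>] by simp
  ultimately show ?thesis by (simp only: termdiffs_strong_converges_everywhere)
qed

lemma continuous_on_mittag_leffler2:
  "0 < \<alpha> \<Longrightarrow> continuous_on A (mittag_leffler2 \<alpha> \<beta>)"
  using mittag_leffler2_powser_has_derivative
  by (meson DERIV_continuous_on has_field_derivative_at_within)

lemma mittag_leffler_has_derivative:
  assumes "0 < \<alpha>"
  shows "(mittag_leffler \<alpha> has_real_derivative mittag_leffler2 \<alpha> \<alpha> z / \<alpha>) (at z)"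
proof -
  have "diffs (\<lambda>n. 1 / Gamma (real n * \<alpha> + 1)) n * z ^ n = z ^ n / Gamma (real n * \<alpha> + \<alpha>) / \<alpha>" for n
  proof -
    have "0 < real n * \<alpha> + \<alpha>" using assms by (simp add: add_nonneg_pos)
    then have "Gamma (real (Suc n) * \<alpha> + 1) = real (Suc n) * (\<alpha> * Gamma (real n * \<alpha> + \<alpha>))"
      using Gamma_plus1_pos[of "real n * \<alpha> + \<alpha>"] by (simp add: algebra_simps)
    then have "diffs (\<lambda>n. 1 / Gamma (real n * \<alpha> + 1)) n = 1 / (\<alpha> * Gamma (real n * \<alpha> + \<alpha>))"
      unfolding diffs_def by (metis mult_divide_mult_cancel_left mult.right_neutral of_nat_neq_0 times_divide_eq_right)
    then show ?thesis by (simp add: mult.commute)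
  qed
  then have "(\<Sum>n. diffs (\<lambda>n. 1 / Gamma (real n * \<alpha> + 1)) n * z ^ n) = mittag_leffler2 \<alpha> \<alpha> z / \<alpha>"
    unfolding mittag_leffler2_def
    by (simp only: suminf_divide[OF summable_mittag_leffler2[OF assms], symmetric])
  then show ?thesis
    using mittag_leffler2_powser_has_derivative[OF assms, of 1 z]
    by (simp add: mittag_leffler_eq_mittag_leffler2)
qed

lemma absolutely_integrable_sums:
  fixes f :: "nat \<Rightarrow> 'a :: euclidean_space \<Rightarrow> real"
  assumes f: "\<And>n. f n absolutely_integrable_on S"
    and pointwise: "\<And>x. x \<in> S \<Longrightarrow> summable (\<lambda>n. \<bar>f n x\<bar>)"
    and norms: "summable (\<lambda>n. integral S (\<lambda>x. \<bar>f n x\<bar>))"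
  shows "(\<lambda>x. \<Sum>n. f n x) absolutely_integrable_on S"
    and "(\<lambda>n. integral S (f n)) sums integral S (\<lambda>x. \<Sum>n. f n x)"
proof -
  define g where "g n x = indicator S x *\<^sub>R f n x" for n x
  have g_integrable: "integrable lebesgue (g n)" for n
    using f[of n] by (simp add: set_integrable_def g_def[abs_def])
  have g_integral: "(\<integral>x. g n x \<partial>lebesgue) = integral S (f n)" for n
    using set_lebesgue_integral_eq_integral(2)[OF f[of n]]
    by (simp add: set_lebesgue_integral_def g_def[abs_def])
  have "(\<integral>x. norm (g n x) \<partial>lebesgue) = integral S (\<lambda>x. \<bar>f n x\<bar>)" for n
  proof -
    have "norm (g n x) = indicator S x *\<^sub>R \<bar>f n x\<bar>" for x by (simp add: g_def abs_mult)
    then show ?thesis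
      using set_lebesgue_integral_eq_integral(2)[OF set_integrable_abs[OF f[of n]]]
      by (simp add: set_lebesgue_integral_def)
  qed
  then have g_norms: "summable (\<lambda>n. \<integral>x. norm (g n x) \<partial>lebesgue)"
    using norms by simp
  have g_pointwise: "AE x in lebesgue. summable (\<lambda>n. norm (g n x))"
    using pointwise by (intro AE_I2) (auto simp: g_def indicator_def)
  have suminf_g: "(\<Sum>n. g n x) = indicator S x *\<^sub>R (\<Sum>n. f n x)" for x
    by (simp add: g_def indicator_def)
  show abs_int: "(\<lambda>x. \<Sum>n. f n x) absolutely_integrable_on S"
    using integrable_suminf[OF g_integrable g_pointwise g_norms]
    by (simp add: set_integrable_def suminf_g)
  show "(\<lambda>n. integral S (f n)) sums integral S (\<lambda>x. \<Sum>n. f n x)"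
    using sums_integral[OF g_integrable g_pointwise g_norms]
      set_lebesgue_integral_eq_integral(2)[OF abs_int]
    by (simp add: g_integral suminf_g set_lebesgue_integral_def)
qed

lemma powr_power_eq:
  fixes s \<alpha> :: real
  assumes "0 < s"
  shows "(s powr \<alpha>) ^ n = s powr (real n * \<alpha>)"
  using assms by (simp add: powr_realpow[symmetric] powr_powr mult.commute)

lemma rl_kernel_mittag_leffler2_term_has_integral:
  assumes "0 < \<alpha>" "0 < \<beta>" "0 < \<gamma>" "0 < t"
  shows "((\<lambda>s. (t - s) powr (\<gamma> - 1) * (s powr (\<beta> - 1) * ((l * s powr \<alpha>) ^ n / Gamma (real n * \<alpha> + \<beta>))))
    has_integral Gamma \<gamma> * t powr (\<beta> + \<gamma> - 1) * ((l * t powr \<alpha>) ^ n / Gamma (real n * \<alpha> + (\<beta> + \<gamma>)))) {0..t}"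
proof -
  define b where "b = real n * \<alpha> + \<beta>"
  have b: "0 < b" using assms by (simp add: b_def add_nonneg_pos)
  have powr_eq: "s powr (\<delta> - 1) * (l * s powr \<alpha>) ^ n = l ^ n * s powr (real n * \<alpha> + \<delta> - 1)" if "0 \<le> s" for s \<delta>
  proof (cases "s = 0")
    case False
    then have "s powr (\<delta> - 1) * (s powr \<alpha>) ^ n = s powr (\<delta> - 1 + real n * \<alpha>)"
      using that by (simp only: powr_add powr_power_eq)
    then show ?thesis by (simp add: power_mult_distrib algebra_simps)
  qed simp
  have terms_eq: "l ^ n / Gamma b * ((t - s) powr (\<gamma> - 1) * s powr (b - 1)) =
      (t - s) powr (\<gamma> - 1) * (s powr (\<beta> - 1) * ((l * s powr \<alpha>) ^ n / Gamma (real n * \<alpha> + \<beta>)))"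
    if "s \<in> {0..t}" for s
    using powr_eq[of s \<beta>] that by (simp add: b_def mult_ac)
  have integral_eq: "l ^ n / Gamma b * (Beta \<gamma> b * t powr (\<gamma> + b - 1))
      = Gamma \<gamma> * t powr (\<beta> + \<gamma> - 1) * ((l * t powr \<alpha>) ^ n / Gamma (real n * \<alpha> + (\<beta> + \<gamma>)))"
    using powr_eq[of t "\<beta> + \<gamma>"] assms(4) Gamma_real_pos[OF b] by (simp add: Beta_def b_def add_ac)
  have "((\<lambda>s. l ^ n / Gamma b * ((t - s) powr (\<gamma> - 1) * s powr (b - 1))) has_integral
      l ^ n / Gamma b * (Beta \<gamma> b * t powr (\<gamma> + b - 1))) {0..t}"
    using Beta_kernel_has_integral[OF assms(3) b assms(4)] by (intro has_integral_mult_right) simp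
  then show ?thesis unfolding integral_eq by (rule has_integral_eq[rotated]) (rule terms_eq)
qed

lemma
  assumes "0 < \<alpha>" "0 < \<beta>" "0 < \<gamma>" "0 < t"
  shows rl_kernel_mittag_leffler2_absolutely_integrable:
      "(\<lambda>s. (t - s) powr (\<gamma> - 1) * (s powr (\<beta> - 1) * mittag_leffler2 \<alpha> \<beta> (l * s powr \<alpha>)))
        absolutely_integrable_on {0..t}"
    and rl_integral_mittag_leffler2:
      "rl_integral \<gamma> (\<lambda>s. s powr (\<beta> - 1) * mittag_leffler2 \<alpha> \<beta> (l * s powr \<alpha>)) t =
        t powr (\<beta> + \<gamma> - 1) * mittag_leffler2 \<alpha> (\<beta> + \<gamma>) (l * t powr \<alpha>)"
proof -
  define f where "f l n s = (t - s) powr (\<gamma> - 1) *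
    (s powr (\<beta> - 1) * ((l * s powr \<alpha>) ^ n / Gamma (real n * \<alpha> + \<beta>)))" for l n s
  define I where "I l n = Gamma \<gamma> * t powr (\<beta> + \<gamma> - 1) *
    ((l * t powr \<alpha>) ^ n / Gamma (real n * \<alpha> + (\<beta> + \<gamma>)))" for l n
  have Gamma_pos: "0 < Gamma (real n * \<alpha> + \<beta>)" for n
    using assms by (simp add: add_nonneg_pos)
  have f_has_integral: "(f l n has_integral I l n) {0..t}" for l n
    unfolding f_def[abs_def] I_def by (rule rl_kernel_mittag_leffler2_term_has_integral[OF assms])
  have abs_f: "\<bar>f l n s\<bar> = f \<bar>l\<bar> n s" for n s
    using Gamma_pos[of n] by (simp add: f_def abs_mult power_abs)
  have f_abs: "f l n absolutely_integrable_on {0..t}" for n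
    using f_has_integral by (intro absolutely_integrable_onI) (auto simp: abs_f integrable_on_def)
  have summable_f: "summable (\<lambda>n. f l n s)" for l s
    unfolding f_def by (intro summable_mult summable_mittag_leffler2 assms)
  have sums_f: "(\<Sum>n. f l n s) =
      (t - s) powr (\<gamma> - 1) * (s powr (\<beta> - 1) * mittag_leffler2 \<alpha> \<beta> (l * s powr \<alpha>))" for s
    unfolding f_def mittag_leffler2_def
    by (simp only: suminf_mult summable_mult summable_mittag_leffler2 assms)
  have summable_I: "summable (I l)" for l
    unfolding I_def[abs_def] by (intro summable_mult summable_mittag_leffler2 assms)
  have norms: "summable (\<lambda>n. integral {0..t} (\<lambda>s. \<bar>f l n s\<bar>))"
    unfolding abs_f integral_unique[OF f_has_integral] by (rule summable_I)
  note series = absolutely_integrable_sums[where f = "f l", OF f_abs _ norms, unfolded abs_f sums_f, OF summable_f]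
  show "(\<lambda>s. (t - s) powr (\<gamma> - 1) * (s powr (\<beta> - 1) * mittag_leffler2 \<alpha> \<beta> (l * s powr \<alpha>)))
      absolutely_integrable_on {0..t}"
    by (rule series(1))
  have "integral {0..t} (\<lambda>s. (t - s) powr (\<gamma> - 1) * (s powr (\<beta> - 1) * mittag_leffler2 \<alpha> \<beta> (l * s powr \<alpha>)))
      = (\<Sum>n. I l n)"
    using series(2) by (simp add: integral_unique[OF f_has_integral] sums_iff)
  also have "\<dots> = Gamma \<gamma> * t powr (\<beta> + \<gamma> - 1) * mittag_leffler2 \<alpha> (\<beta> + \<gamma>) (l * t powr \<alpha>)"
    unfolding I_def mittag_leffler2_def by (intro suminf_mult summable_mittag_leffler2 assms)
  finally show "rl_integral \<gamma> (\<lambda>s. s powr (\<beta> - 1) * mittag_leffler2 \<alpha> \<beta> (l * s powr \<alpha>)) t =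
      t powr (\<beta> + \<gamma> - 1) * mittag_leffler2 \<alpha> (\<beta> + \<gamma>) (l * t powr \<alpha>)"
    using Gamma_real_pos[OF assms(3)] by (simp add: rl_integral_def)
qed

section \<open>The fractional differential equation\<close>

lemma abs_rl_integral_le_powr:
  assumes "0 < \<gamma>" "0 < \<delta>" "0 < t" "continuous_on {0..t} f"
    and bound: "\<And>s. s \<in> {0..t} \<Longrightarrow> \<bar>f s\<bar> \<le> c * s powr (\<delta> - 1)"
  shows "\<bar>rl_integral \<gamma> f t\<bar> \<le> c * (Gamma \<delta> / Gamma (\<gamma> + \<delta>) * t powr (\<gamma> + \<delta> - 1))"
proof -
  have Gamma_pos: "0 < Gamma \<gamma>" using assms by simp
  have majorant: "((\<lambda>s. c * ((t - s) powr (\<gamma> - 1) * s powr (\<delta> - 1))) has_integral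
      c * (Beta \<gamma> \<delta> * t powr (\<gamma> + \<delta> - 1))) {0..t}"
    using Beta_kernel_has_integral[OF assms(1-3)] by (intro has_integral_mult_right) simp
  have "norm (integral {0..t} (\<lambda>s. (t - s) powr (\<gamma> - 1) * f s))
      \<le> integral {0..t} (\<lambda>s. c * ((t - s) powr (\<gamma> - 1) * s powr (\<delta> - 1)))"
  proof (rule Henstock_Kurzweil_Integration.integral_norm_bound_integral)
    show "(\<lambda>s. (t - s) powr (\<gamma> - 1) * f s) integrable_on {0..t}"
      using assms by (intro set_lebesgue_integral_eq_integral(1) rl_kernel_mult_absolutely_integrable) auto
    show "norm ((t - s) powr (\<gamma> - 1) * f s) \<le> c * ((t - s) powr (\<gamma> - 1) * s powr (\<delta> - 1))"
      if "s \<in> {0..t}" for s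
      using mult_left_mono[OF bound[OF that], of "(t - s) powr (\<gamma> - 1)"] by (simp add: abs_mult mult_ac)
  qed (use majorant in blast)
  then show ?thesis
    using Gamma_pos unfolding integral_unique[OF majorant]
    by (simp add: rl_integral_def Beta_def field_simps)
qed

lemma rl_volterra_homogeneous_bound:
  assumes \<alpha>: "0 < \<alpha>" and cont: "continuous_on {0..T} Y"
    and Y: "\<And>t. t \<in> {0..T} \<Longrightarrow> Y t = lam * rl_integral \<alpha> Y t"
    and M: "\<And>t. t \<in> {0..T} \<Longrightarrow> \<bar>Y t\<bar> \<le> M" and "t \<in> {0..T}"
  shows "\<bar>Y t\<bar> \<le> M * \<bar>lam\<bar> ^ n / Gamma (real n * \<alpha> + 1) * t powr (real n * \<alpha>)"
  using \<open>t \<in> {0..T}\<close>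
proof (induction n arbitrary: t)
  case 0
  then show ?case using M[of t] Y[of t] by (cases "t = 0") (auto simp: rl_integral_def)
next
  case (Suc n)
  show ?case
  proof (cases "t = 0")
    case True
    then show ?thesis using Y[OF Suc.prems] by (simp add: rl_integral_def)
  next
    case False
    have Gamma_pos: "0 < Gamma (real n * \<alpha> + 1)" using \<alpha> by (simp add: add_nonneg_pos)
    have "\<bar>rl_integral \<alpha> Y t\<bar> \<le> M * \<bar>lam\<bar> ^ n / Gamma (real n * \<alpha> + 1) *
        (Gamma (real n * \<alpha> + 1) / Gamma (\<alpha> + (real n * \<alpha> + 1)) * t powr (\<alpha> + (real n * \<alpha> + 1) - 1))"
      using \<alpha> Suc False by (intro abs_rl_integral_le_powr continuous_on_subset[OF cont])
        (auto simp: add_nonneg_pos)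
    also have "\<dots> = M * \<bar>lam\<bar> ^ n / Gamma (real (Suc n) * \<alpha> + 1) * t powr (real (Suc n) * \<alpha>)"
      using Gamma_pos by (simp add: algebra_simps)
    finally have "\<bar>lam\<bar> * \<bar>rl_integral \<alpha> Y t\<bar> \<le>
        \<bar>lam\<bar> * (M * \<bar>lam\<bar> ^ n / Gamma (real (Suc n) * \<alpha> + 1) * t powr (real (Suc n) * \<alpha>))"
      by (intro mult_left_mono) auto
    then show ?thesis
      unfolding Y[OF Suc.prems] abs_mult power_Suc
      by (simp only: mult_ac times_divide_eq_right times_divide_eq_left)
  qed
qed

text \<open>The iterated bounds are the terms of a convergent Mittag-Leffler series.\<close>

lemma rl_volterra_homogeneous_eq_0:
  assumes \<alpha>: "0 < \<alpha>" and cont: "continuous_on {0..T} Y"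
    and Y: "\<And>t. t \<in> {0..T} \<Longrightarrow> Y t = lam * rl_integral \<alpha> Y t" and t: "t \<in> {0..T}"
  shows "Y t = 0"
proof (cases "t = 0")
  case True
  then show ?thesis using Y[OF t] by (simp add: rl_integral_def)
next
  case False
  have "compact (Y ` {0..T})" by (intro compact_continuous_image cont) auto
  then obtain M where M: "\<And>s. s \<in> {0..T} \<Longrightarrow> \<bar>Y s\<bar> \<le> M"
    by (metis compact_imp_bounded bounded_iff imageI real_norm_def)
  have "M * \<bar>lam\<bar> ^ n / Gamma (real n * \<alpha> + 1) * t powr (real n * \<alpha>)
      = M * ((\<bar>lam\<bar> * t powr \<alpha>) ^ n / Gamma (real n * \<alpha> + 1))" for n
    using t False by (simp add: powr_power_eq power_mult_distrib)
  then have "\<bar>Y t\<bar> \<le> M * ((\<bar>lam\<bar> * t powr \<alpha>) ^ n / Gamma (real n * \<alpha> + 1))" for n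
    using rl_volterra_homogeneous_bound[OF \<alpha> cont Y M t, of n] by metis
  moreover have "(\<lambda>n. M * ((\<bar>lam\<bar> * t powr \<alpha>) ^ n / Gamma (real n * \<alpha> + 1))) \<longlonglongrightarrow> 0"
    by (intro summable_LIMSEQ_zero summable_mult summable_mittag_leffler2 \<alpha>)
  ultimately have "\<bar>Y t\<bar> \<le> 0" by (intro LIMSEQ_le_const) auto
  then show ?thesis by simp
qed

lemma caputo_deriv_eq_rl_integral: "caputo_deriv \<alpha> X t = rl_integral (1 - \<alpha>) (deriv X) t"
  by (simp add: caputo_deriv_def rl_integral_def powr_minus divide_inverse mult.commute)

text \<open>Fractional integration of order \<open>\<alpha>\<close> turns the Caputo derivative into the integral of the derivative.\<close>

lemma fode_solution_volterra:
  assumes \<alpha>: "0 < \<alpha>" "\<alpha> < 1" and X: "fode_solution \<alpha> lam x0 X" and "0 \<le> t"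
  shows "X t = x0 + lam * rl_integral \<alpha> X t"
proof (cases "t = 0")
  case True
  then show ?thesis using X by (simp add: fode_solution_def rl_integral_def)
next
  case False
  then have t: "0 < t" using \<open>0 \<le> t\<close> by simp
  have cont: "continuous_on {0..t} X"
    using X by (auto simp: fode_solution_def intro: continuous_on_subset)
  have X_deriv: "(X has_real_derivative deriv X s) (at s)" if "0 < s" for s
    using X that by (auto simp: fode_solution_def DERIV_deriv_iff_real_differentiable)
  have "(\<lambda>s. (t - s) powr \<alpha> * (deriv X s / (t - s) powr \<alpha>)) absolutely_integrable_on {0..t}"
  proof (rule absolutely_integrable_bounded_measurable_product_real)
    have "continuous_on {0..t} (\<lambda>s. (t - s) powr \<alpha>)"
      using \<alpha> by (intro continuous_on_powr' continuous_intros) auto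
    then show "(\<lambda>s. (t - s) powr \<alpha>) \<in> borel_measurable (lebesgue_on {0..t})"
      "bounded ((\<lambda>s. (t - s) powr \<alpha>) ` {0..t})"
      by (auto intro!: continuous_imp_measurable_on_sets_lebesgue compact_imp_bounded compact_continuous_image)
    show "(\<lambda>s. deriv X s / (t - s) powr \<alpha>) absolutely_integrable_on {0..t}"
      using X t by (simp add: fode_solution_def)
  qed simp
  then have "(\<lambda>s. (t - s) powr (\<alpha> + (1 - \<alpha>) - 1) * deriv X s) absolutely_integrable_on {0..t}"
    by (rule absolutely_integrable_spike[of _ _ "{t}"]) auto
  then have "rl_integral \<alpha> (rl_integral (1 - \<alpha>) (deriv X)) t = rl_integral (\<alpha> + (1 - \<alpha>)) (deriv X) t"
    using \<alpha> by (intro rl_integral_compose) auto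
  also have "\<dots> = integral {0..t} (deriv X)"
    by (simp add: rl_integral_def) (rule integral_spike[of "{t}"], auto)
  also have "\<dots> = X t - x0"
  proof -
    have "(deriv X has_integral (X t - X 0)) {0..t}"
      using t cont X_deriv by (intro fundamental_theorem_of_calculus_interior)
        (auto simp: has_real_derivative_iff_has_vector_derivative[symmetric])
    then show ?thesis using X by (simp add: integral_unique fode_solution_def)
  qed
  also have "rl_integral \<alpha> (rl_integral (1 - \<alpha>) (deriv X)) t = rl_integral \<alpha> (\<lambda>s. lam * X s) t"
    using X by (intro rl_integral_spike[of "{0}"])
      (auto simp: fode_solution_def caputo_deriv_eq_rl_integral)
  finally show ?thesis by (simp add: rl_integral_cmult)
qed

lemma exact_sol_0: "exact_sol \<alpha> lam x0 0 = x0"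
proof -
  have "(\<Sum>n. 1 / Gamma (real n * \<alpha> + 1) * 0 ^ n) = (1::real)"
    using powser_zero[of "\<lambda>n. 1 / Gamma (real n * \<alpha> + 1)"] by simp
  then show ?thesis by (simp add: exact_sol_def mittag_leffler_def)
qed

lemma exact_sol_continuous:
  assumes "0 < \<alpha>"
  shows "continuous_on {0..} (exact_sol \<alpha> lam x0)"
proof -
  have "continuous_on {0..} (\<lambda>t::real. lam * t powr \<alpha>)"
    using assms by (intro continuous_intros continuous_on_powr') auto
  then have "continuous_on {0..} (\<lambda>t. mittag_leffler2 \<alpha> 1 (lam * t powr \<alpha>))"
    by (rule continuous_on_compose2[OF continuous_on_mittag_leffler2[OF assms, of UNIV]]) auto
  then show ?thesis
    unfolding exact_sol_def[abs_def] mittag_leffler_eq_mittag_leffler2 by (intro continuous_intros)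
qed

lemma exact_sol_has_derivative:
  assumes "0 < \<alpha>" "0 < t"
  shows "(exact_sol \<alpha> lam x0 has_real_derivative
    x0 * lam * (t powr (\<alpha> - 1) * mittag_leffler2 \<alpha> \<alpha> (lam * t powr \<alpha>))) (at t)"
proof -
  have "(exact_sol \<alpha> lam x0 has_real_derivative
      x0 * (mittag_leffler2 \<alpha> \<alpha> (lam * t powr \<alpha>) / \<alpha> * (lam * (\<alpha> * t powr (\<alpha> - 1))))) (at t)"
    unfolding exact_sol_def[abs_def] using assms
    by (intro DERIV_cmult DERIV_chain2[OF mittag_leffler_has_derivative] has_real_derivative_powr)
  then show ?thesis using assms by (simp add: mult_ac)
qed

lemma exact_sol_fode_solution:
  assumes \<alpha>: "0 < \<alpha>" "\<alpha> < 1" and X: "\<And>t. 0 \<le> t \<Longrightarrow> X t = exact_sol \<alpha> lam x0 t"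
  shows "fode_solution \<alpha> lam x0 X"
proof -
  define D where "D s = s powr (\<alpha> - 1) * mittag_leffler2 \<alpha> \<alpha> (lam * s powr \<alpha>)" for s
  have X_deriv: "(X has_real_derivative x0 * lam * D s) (at s)" if "0 < s" for s
    unfolding D_def
    by (rule has_field_derivative_transform_within_open[OF exact_sol_has_derivative[OF \<alpha>(1) that], of "{0<..}"])
      (use that X in auto)
  then have deriv_eq: "deriv X s = x0 * lam * D s" if "0 < s" for s
    using that by (simp add: DERIV_imp_deriv)
  have "continuous_on {0..} X"
    by (rule continuous_on_eq[OF exact_sol_continuous[OF \<alpha>(1), of lam x0]]) (use X in auto)
  moreover have "X differentiable (at t)" if "0 < t" for t
    using X_deriv[OF that] real_differentiable_def by blast
  moreover have "(\<lambda>s. deriv X s / (t - s) powr \<alpha>) absolutely_integrable_on {0..t}" if "0 < t" for t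
  proof (rule absolutely_integrable_spike)
    show "(\<lambda>s. x0 * lam * ((t - s) powr (1 - \<alpha> - 1) * D s)) absolutely_integrable_on {0..t}"
      unfolding D_def using \<alpha> that
      by (intro set_integrable_mult_right rl_kernel_mittag_leffler2_absolutely_integrable) auto
    show "deriv X s / (t - s) powr \<alpha> = x0 * lam * ((t - s) powr (1 - \<alpha> - 1) * D s)"
      if "s \<in> {0..t} - {0}" for s
      using that by (simp add: deriv_eq powr_minus divide_inverse)
  qed simp
  moreover have "caputo_deriv \<alpha> X t = lam * X t" if "0 < t" for t
  proof -
    have "caputo_deriv \<alpha> X t = rl_integral (1 - \<alpha>) (\<lambda>s. x0 * lam * D s) t"
      unfolding caputo_deriv_eq_rl_integral
      by (rule rl_integral_spike[of "{0}"]) (auto simp: deriv_eq)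
    also have "\<dots> = x0 * lam * mittag_leffler2 \<alpha> 1 (lam * t powr \<alpha>)"
      unfolding rl_integral_cmult D_def using rl_integral_mittag_leffler2[of \<alpha> \<alpha> "1 - \<alpha>" t lam] \<alpha> that by simp
    finally show ?thesis
      using X[of t] that by (simp add: exact_sol_def mittag_leffler_eq_mittag_leffler2)
  qed
  ultimately show ?thesis
    using X[of 0] by (simp add: fode_solution_def exact_sol_0)
qed

lemma exact_sol_volterra:
  assumes "0 < \<alpha>" "\<alpha> < 1" "0 \<le> t"
  shows "exact_sol \<alpha> lam x0 t = x0 + lam * rl_integral \<alpha> (exact_sol \<alpha> lam x0) t"
  using fode_solution_volterra[OF assms(1,2) exact_sol_fode_solution[OF assms(1,2)] assms(3)] by simp

lemma fode_solution_iff_exact_sol: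
  assumes \<alpha>: "0 < \<alpha>" "\<alpha> < 1"
  shows "fode_solution \<alpha> lam x0 X \<longleftrightarrow> (\<forall>t\<ge>0. X t = exact_sol \<alpha> lam x0 t)"
proof
  assume X: "fode_solution \<alpha> lam x0 X"
  let ?E = "exact_sol \<alpha> lam x0"
  show "\<forall>t\<ge>0. X t = ?E t"
  proof (intro allI impI)
    fix t :: real assume "0 \<le> t"
    have cont: "continuous_on {0..s} X" "continuous_on {0..s} ?E" for s
      using X exact_sol_continuous[OF \<alpha>(1), of lam x0]
      by (auto simp: fode_solution_def intro: continuous_on_subset)
    have "X t - ?E t = 0"
    proof (rule rl_volterra_homogeneous_eq_0[OF \<alpha>(1), where Y = "\<lambda>s. X s - ?E s"])
      show "continuous_on {0..t} (\<lambda>s. X s - ?E s)" by (intro continuous_intros cont)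
      show "X s - ?E s = lam * rl_integral \<alpha> (\<lambda>s. X s - ?E s) s" if "s \<in> {0..t}" for s
        using fode_solution_volterra[OF \<alpha> X, of s] exact_sol_volterra[OF \<alpha>, of s lam x0]
          rl_integral_diff[OF \<alpha>(1) _ cont, of s] that
        by (simp add: right_diff_distrib)
    qed (use \<open>0 \<le> t\<close> in simp)
    then show "X t = ?E t" by simp
  qed
qed (use exact_sol_fode_solution[OF \<alpha>] in blast)

section \<open>Comparison of the scheme with the exact solution\<close>

lemma rl_integral_le_volterra_conv:
  assumes "0 < \<alpha>" "0 < k" and cont: "continuous_on {0..real n * k} f"
    and y: "\<And>j s. j < n \<Longrightarrow> s \<in> {real j * k..real (Suc j) * k} \<Longrightarrow> f s \<le> y (Suc j)"
  shows "rl_integral \<alpha> f (real n * k) \<le> k powr \<alpha> * volterra_conv (coeff_a \<alpha>) y n"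
proof -
  define t where "t = real n * k"
  define g where "g s = (t - s) powr (\<alpha> - 1) * f s" for s
  have g_integrable: "g integrable_on {0..t}"
    using rl_kernel_mult_absolutely_integrable[OF assms(1) _ cont] assms(2)
    unfolding g_def[abs_def] t_def by (intro set_lebesgue_integral_eq_integral(1)) simp
  have cell: "integral {real j * k..real (Suc j) * k} g
      \<le> Gamma \<alpha> * k powr \<alpha> * coeff_a \<alpha> (n - Suc j) * y (Suc j)" if "j < n" for j
  proof (rule has_integral_le)
    have le: "real j * k \<le> real (Suc j) * k" "real (Suc j) * k \<le> t"
      using \<open>j < n\<close> assms(2) unfolding t_def by (auto intro!: mult_right_mono)
    then show "(g has_integral integral {real j * k..real (Suc j) * k} g) {real j * k..real (Suc j) * k}"
      using assms(2) by (intro integrable_integral integrable_on_subinterval[OF g_integrable]) auto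
    have "t - real j * k = real (Suc (n - Suc j)) * k" "t - real (Suc j) * k = real (n - Suc j) * k"
      using \<open>j < n\<close> by (simp_all add: t_def of_nat_diff algebra_simps)
    then have "((\<lambda>s. (t - s) powr (\<alpha> - 1)) has_integral Gamma \<alpha> * k powr \<alpha> * coeff_a \<alpha> (n - Suc j))
        {real j * k..real (Suc j) * k}"
      using rl_kernel_has_integral[OF assms(1) le] by (simp only: powr_grid_diff[OF assms(1)])
    then show "((\<lambda>s. (t - s) powr (\<alpha> - 1) * y (Suc j)) has_integral
        Gamma \<alpha> * k powr \<alpha> * coeff_a \<alpha> (n - Suc j) * y (Suc j)) {real j * k..real (Suc j) * k}"
      by (rule has_integral_mult_left)
    show "g s \<le> (t - s) powr (\<alpha> - 1) * y (Suc j)" if "s \<in> {real j * k..real (Suc j) * k}" for s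
      unfolding g_def using y[OF \<open>j < n\<close> that] by (intro mult_left_mono) auto
  qed
  have "integral {0..t} g = (\<Sum>j=0..<n. integral {real j * k..real (Suc j) * k} g)"
    using integral_grid_sum[of k 0 n g] g_integrable assms(2) by (simp add: t_def)
  also have "\<dots> \<le> (\<Sum>j=0..<n. Gamma \<alpha> * k powr \<alpha> * coeff_a \<alpha> (n - Suc j) * y (Suc j))"
    by (intro sum_mono cell) simp
  also have "\<dots> = Gamma \<alpha> * (k powr \<alpha> * volterra_conv (coeff_a \<alpha>) y n)"
    by (simp add: volterra_conv_def sum.atLeast1_atMost_eq lessThan_atLeast0 sum_distrib_left mult.assoc)
  finally show ?thesis
    using Gamma_real_pos[OF assms(1)] by (simp add: rl_integral_def g_def[abs_def] t_def field_simps)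
qed

lemma abs_rl_integral_minus_volterra_conv_le:
  assumes "0 < \<alpha>" "0 < k" and cont: "continuous_on {0..real n * k} f"
    and osc: "\<And>j s. j < n \<Longrightarrow> s \<in> {real j * k..real (Suc j) * k} \<Longrightarrow> \<bar>f (real (Suc j) * k) - f s\<bar> \<le> \<epsilon>"
  shows "\<bar>rl_integral \<alpha> f (real n * k) - k powr \<alpha> * volterra_conv (coeff_a \<alpha>) (\<lambda>m. f (real m * k)) n\<bar>
    \<le> (real n * k) powr \<alpha> / Gamma (1 + \<alpha>) * \<epsilon>"
proof -
  let ?V = "\<lambda>f. volterra_conv (coeff_a \<alpha>) (\<lambda>m. f (real m * k)) n"
  have "volterra_conv (coeff_a \<alpha>) (\<lambda>m. \<epsilon>) n = real n powr \<alpha> / Gamma (1 + \<alpha>) * \<epsilon>"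
    by (simp only: volterra_conv_const sum_coeff_a)
  then have const: "k powr \<alpha> * volterra_conv (coeff_a \<alpha>) (\<lambda>m. \<epsilon>) n
      = (real n * k) powr \<alpha> / Gamma (1 + \<alpha>) * \<epsilon>"
    by (simp add: powr_mult)
  have upper: "rl_integral \<alpha> f (real n * k) - k powr \<alpha> * ?V f
      \<le> (real n * k) powr \<alpha> / Gamma (1 + \<alpha>) * \<epsilon>"
    if "continuous_on {0..real n * k} f"
      "\<And>j s. j < n \<Longrightarrow> s \<in> {real j * k..real (Suc j) * k} \<Longrightarrow> f s \<le> f (real (Suc j) * k) + \<epsilon>" for f
    using rl_integral_le_volterra_conv[of \<alpha> k n f "\<lambda>m. f (real m * k) + \<epsilon>"] assms that
    by (simp add: volterra_conv_add distrib_left const)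
  have osc': "f s \<le> f (real (Suc j) * k) + \<epsilon>" "- f s \<le> - f (real (Suc j) * k) + \<epsilon>"
    if "j < n" "s \<in> {real j * k..real (Suc j) * k}" for j s
    using osc[OF that] by (auto simp: abs_le_iff)
  have "rl_integral \<alpha> (\<lambda>s. - f s) t = - rl_integral \<alpha> f t" for t
    using rl_integral_cmult[of \<alpha> "-1" f] by simp
  moreover have "?V (\<lambda>s. - f s) = - ?V f"
    using volterra_conv_diff[of "coeff_a \<alpha>" "\<lambda>_. 0"] by (simp add: volterra_conv_const)
  ultimately show ?thesis
    using upper[OF cont osc'(1)] upper[of "\<lambda>s. - f s", OF continuous_on_minus[OF cont] osc'(2)]
    by (simp add: abs_le_iff)
qed

lemma exact_sol_mono:
  assumes "0 < \<alpha>" "0 \<le> lam" "0 \<le> x0" "0 \<le> s" "s \<le> t"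
  shows "exact_sol \<alpha> lam x0 s \<le> exact_sol \<alpha> lam x0 t"
  unfolding exact_sol_def mittag_leffler_eq_mittag_leffler2 using assms
  by (intro mult_left_mono mittag_leffler2_mono powr_mono2) auto

text \<open>The right-endpoint rule overestimates the fractional integral of a nondecreasing function, so the
  exact solution is a subsolution of the scheme.\<close>

lemma exact_sol_le_implicit_scheme:
  assumes \<alpha>: "0 < \<alpha>" "\<alpha> < 1" and "0 \<le> lam" "0 < k" "k powr \<alpha> * lam < coeff_c \<alpha> 0" "0 \<le> x0"
    and X: "implicit_scheme \<alpha> lam k x0 X"
  shows "exact_sol \<alpha> lam x0 (real n * k) \<le> X n"
proof (cases n)
  case 0
  then show ?thesis
    using implicit_schemeD[OF \<alpha>(1) \<open>0 < k\<close> X, of 0] by (simp add: exact_sol_0)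
next
  case (Suc l)
  let ?E = "exact_sol \<alpha> lam x0"
  interpret nonneg_volterra_kernel "coeff_a \<alpha>" "lam * k powr \<alpha>"
    using assms by (intro nonneg_volterra_kernel_coeff_a)
  show ?thesis
  proof (rule subsolution_le_supersolution[where u = "\<lambda>i. ?E (real i * k)" and g = "\<lambda>_. x0" and N = n])
    fix i
    have "rl_integral \<alpha> ?E (real i * k) \<le> k powr \<alpha> * volterra_conv (coeff_a \<alpha>) (\<lambda>m. ?E (real m * k)) i"
    proof (rule rl_integral_le_volterra_conv[OF \<alpha>(1) \<open>0 < k\<close>])
      show "continuous_on {0..real i * k} ?E"
        by (rule continuous_on_subset[OF exact_sol_continuous[OF \<alpha>(1)]]) auto
      fix j s assume s: "s \<in> {real j * k..real (Suc j) * k}"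
      have "0 \<le> real j * k" using \<open>0 < k\<close> by simp
      with s have "0 \<le> s" "s \<le> real (Suc j) * k" by simp_all
      then show "?E s \<le> ?E (real (Suc j) * k)" using assms by (intro exact_sol_mono)
    qed
    then have "lam * rl_integral \<alpha> ?E (real i * k)
        \<le> lam * (k powr \<alpha> * volterra_conv (coeff_a \<alpha>) (\<lambda>m. ?E (real m * k)) i)"
      using \<open>0 \<le> lam\<close> by (rule mult_left_mono)
    then show "?E (real i * k) \<le> x0 + lam * k powr \<alpha> * volterra_conv (coeff_a \<alpha>) (\<lambda>m. ?E (real m * k)) i"
      using exact_sol_volterra[OF \<alpha>, of "real i * k" lam x0] \<open>0 < k\<close> by (simp add: mult.assoc)
    show "x0 + lam * k powr \<alpha> * volterra_conv (coeff_a \<alpha>) X i \<le> X i"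
      using implicit_schemeD[OF \<alpha>(1) \<open>0 < k\<close> X, of i] by simp
  qed (use Suc in auto)
qed

section \<open>The error estimate\<close>

lemma rl_integral_holder_quadrature:
  assumes "0 < \<alpha>" "0 < \<beta>" "0 < k" "real n * k \<le> T" and cont: "continuous_on {0..T} f"
    and "0 \<le> L" and holder: "\<And>s t. \<lbrakk>0 \<le> s; s \<le> t; t \<le> T\<rbrakk> \<Longrightarrow> \<bar>f t - f s\<bar> \<le> L * (t - s) powr \<beta>"
  shows "\<bar>rl_integral \<alpha> f (real n * k) - k powr \<alpha> * volterra_conv (coeff_a \<alpha>) (\<lambda>m. f (real m * k)) n\<bar>
    \<le> T powr \<alpha> / Gamma (1 + \<alpha>) * (L * k powr \<beta>)"
proof -
  have "\<bar>rl_integral \<alpha> f (real n * k) - k powr \<alpha> * volterra_conv (coeff_a \<alpha>) (\<lambda>m. f (real m * k)) n\<bar>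
      \<le> (real n * k) powr \<alpha> / Gamma (1 + \<alpha>) * (L * k powr \<beta>)"
  proof (rule abs_rl_integral_minus_volterra_conv_le[OF assms(1,3)])
    show "continuous_on {0..real n * k} f"
      using assms(4) by (intro continuous_on_subset[OF cont]) auto
    fix j s assume j: "j < n" "s \<in> {real j * k..real (Suc j) * k}"
    have "0 \<le> real j * k" using assms(3) by simp
    with j have "0 \<le> s" "s \<le> real (Suc j) * k" by simp_all
    moreover have "real (Suc j) * k \<le> real n * k" using j assms(3) by (intro mult_right_mono) auto
    then have "real (Suc j) * k \<le> T" using assms(4) by (rule order_trans)
    ultimately have "\<bar>f (real (Suc j) * k) - f s\<bar> \<le> L * (real (Suc j) * k - s) powr \<beta>"
      by (rule holder)
    also have "\<dots> \<le> L * k powr \<beta>"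
      using j assms by (intro mult_left_mono powr_mono2) (auto simp: algebra_simps)
    finally show "\<bar>f (real (Suc j) * k) - f s\<bar> \<le> L * k powr \<beta>" .
  qed
  also have "\<dots> \<le> T powr \<alpha> / Gamma (1 + \<alpha>) * (L * k powr \<beta>)"
    using assms by (intro mult_right_mono divide_right_mono powr_mono2) (auto simp: less_imp_le)
  finally show ?thesis .
qed

lemma powr_diff_le_powr:
  fixes s t \<alpha> :: real
  assumes "0 < \<alpha>" "\<alpha> \<le> 1" "0 \<le> s" "s \<le> t"
  shows "t powr \<alpha> - s powr \<alpha> \<le> (t - s) powr \<alpha>"
proof (cases "t = 0")
  case False
  with assms have t: "0 < t" by simp
  have le: "p \<le> p powr \<alpha>" if "0 \<le> p" "p \<le> 1" for p :: real
    using that assms powr_mono'[of \<alpha> 1 p] by (cases "p = 0") auto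
  have "1 = s / t + (t - s) / t" using t by (simp add: field_simps)
  also have "\<dots> \<le> (s / t) powr \<alpha> + ((t - s) / t) powr \<alpha>"
    using assms t by (intro add_mono le) auto
  also have "\<dots> = (s powr \<alpha> + (t - s) powr \<alpha>) / t powr \<alpha>"
    using assms t by (simp add: powr_divide add_divide_distrib)
  finally show ?thesis using t by (simp add: field_simps)
qed (use assms in simp)

lemma mittag_leffler_locally_lipschitz:
  assumes "0 < \<alpha>"
  obtains L where "0 \<le> L"
    "\<And>x y. x \<in> {-b..b} \<Longrightarrow> y \<in> {-b..b} \<Longrightarrow> \<bar>mittag_leffler \<alpha> x - mittag_leffler \<alpha> y\<bar> \<le> L * \<bar>x - y\<bar>"
proof -
  have "compact ((\<lambda>z. mittag_leffler2 \<alpha> \<alpha> z / \<alpha>) ` {-b..b})"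
    using assms by (intro compact_continuous_image continuous_on_divide continuous_on_mittag_leffler2) auto
  from compact_imp_bounded[OF this]
  obtain L where L: "0 < L" "\<And>z. z \<in> {-b..b} \<Longrightarrow> norm (mittag_leffler2 \<alpha> \<alpha> z / \<alpha>) \<le> L"
    unfolding bounded_pos by blast
  have "norm (mittag_leffler \<alpha> x - mittag_leffler \<alpha> y) \<le> L * norm (x - y)"
    if "x \<in> {-b..b}" "y \<in> {-b..b}" for x y
    using that L(2) mittag_leffler_has_derivative[OF assms]
    by (intro field_differentiable_bound[where S = "{-b..b}"]) (auto intro: has_field_derivative_at_within)
  with L(1) show thesis by (intro that[of L]) auto
qed

lemma exact_sol_holder:
  assumes \<alpha>: "0 < \<alpha>" "\<alpha> \<le> 1"
  obtains L where "0 \<le> L"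
    "\<And>s t. \<lbrakk>0 \<le> s; s \<le> t; t \<le> T\<rbrakk> \<Longrightarrow> \<bar>exact_sol \<alpha> lam x0 t - exact_sol \<alpha> lam x0 s\<bar> \<le> L * (t - s) powr \<alpha>"
proof -
  define b where "b = \<bar>lam\<bar> * T powr \<alpha>"
  obtain L where L: "0 \<le> L" "\<And>x y. x \<in> {-b..b} \<Longrightarrow> y \<in> {-b..b} \<Longrightarrow>
      \<bar>mittag_leffler \<alpha> x - mittag_leffler \<alpha> y\<bar> \<le> L * \<bar>x - y\<bar>"
    using mittag_leffler_locally_lipschitz[OF \<alpha>(1)] by blast
  have in_b: "lam * u powr \<alpha> \<in> {-b..b}" if "0 \<le> u" "u \<le> T" for u
  proof -
    have "\<bar>lam * u powr \<alpha>\<bar> \<le> b"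
      unfolding b_def abs_mult using that \<alpha> by (intro mult_left_mono) (auto intro!: powr_mono2)
    then show ?thesis by (auto simp: abs_le_iff)
  qed
  show thesis
  proof
    show "0 \<le> \<bar>x0\<bar> * (L * \<bar>lam\<bar>)" using L(1) by simp
    fix s t :: real assume st: "0 \<le> s" "s \<le> t" "t \<le> T"
    have "\<bar>lam * t powr \<alpha> - lam * s powr \<alpha>\<bar> = \<bar>lam\<bar> * (t powr \<alpha> - s powr \<alpha>)"
      using powr_mono2[of \<alpha> s t] \<alpha> st by (simp add: right_diff_distrib[symmetric] abs_mult)
    also have "\<dots> \<le> \<bar>lam\<bar> * (t - s) powr \<alpha>"
      using powr_diff_le_powr[OF \<alpha> st(1,2)] by (intro mult_left_mono) auto
    finally have "\<bar>mittag_leffler \<alpha> (lam * t powr \<alpha>) - mittag_leffler \<alpha> (lam * s powr \<alpha>)\<bar>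
        \<le> L * (\<bar>lam\<bar> * (t - s) powr \<alpha>)"
      using L(2)[OF in_b[of t] in_b[of s]] st L(1) by (meson mult_left_mono order_trans)
    from mult_left_mono[OF this abs_ge_zero[of x0]]
    show "\<bar>exact_sol \<alpha> lam x0 t - exact_sol \<alpha> lam x0 s\<bar> \<le> \<bar>x0\<bar> * (L * \<bar>lam\<bar>) * (t - s) powr \<alpha>"
      by (simp add: exact_sol_def right_diff_distrib[symmetric] abs_mult mult.assoc)
  qed
qed

lemma exact_sol_consistency:
  assumes \<alpha>: "0 < \<alpha>" "\<alpha> < 1"
  obtains \<rho> where "0 \<le> \<rho>"
    "\<And>k n. \<lbrakk>0 < k; real n * k \<le> T\<rbrakk> \<Longrightarrow>
      \<bar>exact_sol \<alpha> lam x0 (real n * k) - (x0 + lam * k powr \<alpha> *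
         volterra_conv (coeff_a \<alpha>) (\<lambda>m. exact_sol \<alpha> lam x0 (real m * k)) n)\<bar> \<le> \<rho> * k powr \<alpha>"
proof -
  let ?E = "exact_sol \<alpha> lam x0"
  obtain L where L: "0 \<le> L" "\<And>s t. \<lbrakk>0 \<le> s; s \<le> t; t \<le> T\<rbrakk> \<Longrightarrow> \<bar>?E t - ?E s\<bar> \<le> L * (t - s) powr \<alpha>"
    using exact_sol_holder[OF \<alpha>(1) less_imp_le[OF \<alpha>(2)]] by metis
  show thesis
  proof
    show "0 \<le> \<bar>lam\<bar> * (T powr \<alpha> / Gamma (1 + \<alpha>) * L)"
      using L(1) \<alpha> by (simp add: less_imp_le)
    fix k n assume k: "0 < k" "real n * k \<le> T"
    let ?V = "volterra_conv (coeff_a \<alpha>) (\<lambda>m. ?E (real m * k)) n"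
    have "\<bar>rl_integral \<alpha> ?E (real n * k) - k powr \<alpha> * ?V\<bar> \<le> T powr \<alpha> / Gamma (1 + \<alpha>) * (L * k powr \<alpha>)"
      by (rule rl_integral_holder_quadrature[OF \<alpha>(1) \<alpha>(1) k _ L])
        (auto intro: continuous_on_subset[OF exact_sol_continuous[OF \<alpha>(1)]])
    from mult_left_mono[OF this abs_ge_zero[of lam]]
    have "\<bar>lam * (rl_integral \<alpha> ?E (real n * k) - k powr \<alpha> * ?V)\<bar>
        \<le> \<bar>lam\<bar> * (T powr \<alpha> / Gamma (1 + \<alpha>) * L) * k powr \<alpha>"
      by (simp add: abs_mult mult.assoc)
    moreover have "?E (real n * k) - (x0 + lam * k powr \<alpha> * ?V)
        = lam * (rl_integral \<alpha> ?E (real n * k) - k powr \<alpha> * ?V)"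
      using exact_sol_volterra[OF \<alpha>, of "real n * k" lam x0] k by (simp add: right_diff_distrib mult.assoc)
    ultimately show "\<bar>?E (real n * k) - (x0 + lam * k powr \<alpha> * ?V)\<bar>
        \<le> \<bar>lam\<bar> * (T powr \<alpha> / Gamma (1 + \<alpha>) * L) * k powr \<alpha>"
      by simp
  qed
qed

lemma implicit_scheme_error:
  assumes \<alpha>: "0 < \<alpha>" "\<alpha> < 1"
  obtains C where
    "\<And>k X n. \<lbrakk>0 < k; k powr \<alpha> * \<bar>lam\<bar> \<le> 1 / 2 * coeff_c \<alpha> 0; implicit_scheme \<alpha> lam k x0 X; real n * k \<le> T\<rbrakk>
      \<Longrightarrow> \<bar>X n - exact_sol \<alpha> lam x0 (real n * k)\<bar> \<le> C * k powr \<alpha>"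
proof -
  let ?E = "exact_sol \<alpha> lam x0"
  obtain \<rho> where \<rho>: "0 \<le> \<rho>" "\<And>k n. \<lbrakk>0 < k; real n * k \<le> T\<rbrakk> \<Longrightarrow>
      \<bar>?E (real n * k) - (x0 + lam * k powr \<alpha> * volterra_conv (coeff_a \<alpha>) (\<lambda>m. ?E (real m * k)) n)\<bar>
      \<le> \<rho> * k powr \<alpha>"
    using exact_sol_consistency[OF \<alpha>] by metis
  have "\<bar>X n - ?E (real n * k)\<bar> \<le> 4 * \<rho> * exp (gronwall_rate \<alpha> \<bar>lam\<bar> * T) * k powr \<alpha>"
    if k: "0 < k" "k powr \<alpha> * \<bar>lam\<bar> \<le> 1 / 2 * coeff_c \<alpha> 0"
      and X: "implicit_scheme \<alpha> lam k x0 X" and n: "real n * k \<le> T" for k X n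
  proof -
    define e where "e i = \<bar>X i - ?E (real i * k)\<bar>" for i
    have recursion: "e i \<le> \<rho> * k powr \<alpha> + \<bar>lam\<bar> * k powr \<alpha> * volterra_conv (coeff_a \<alpha>) e i" if "i \<le> n" for i
    proof -
      have "real i * k \<le> real n * k" using that k by (intro mult_right_mono) auto
      then have "real i * k \<le> T" using n by (rule order_trans)
      then show ?thesis
        using volterra_perturbation_le[OF _ implicit_schemeD[OF \<alpha>(1) k(1) X] \<rho>(2)[OF k(1)], of i]
          coeff_a_pos[OF \<alpha>(1)] by (simp add: e_def[abs_def] abs_mult less_imp_le)
    qed
    have "e n \<le> 4 * (\<rho> * k powr \<alpha>) * exp (gronwall_rate \<alpha> \<bar>lam\<bar> * (real n * k))"
    proof (cases "n = 0")
      case True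
      have "e 0 = 0" using X by (simp add: e_def exact_sol_0 implicit_scheme_def)
      then show ?thesis using True \<rho>(1) by simp
    next
      case False
      then show ?thesis
        using \<alpha> k \<rho>(1) recursion by (intro discrete_fractional_gronwall[where N = n]) auto
    qed
    also have "\<dots> \<le> 4 * (\<rho> * k powr \<alpha>) * exp (gronwall_rate \<alpha> \<bar>lam\<bar> * T)"
      using \<rho>(1) n by (intro mult_left_mono) (auto simp: gronwall_rate_def intro!: mult_left_mono)
    finally show ?thesis by (simp add: e_def mult_ac)
  qed
  then show thesis by (rule that)
qed

lemma cSUP_grid_le:
  fixes f :: "nat \<Rightarrow> real"
  assumes "0 \<le> T" "\<And>n. real n * k \<le> T \<Longrightarrow> f n \<le> B"
  shows "(SUP n\<in>{n. real n * k \<le> T}. f n) \<le> B"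
  using assms by (intro cSUP_least) (auto intro!: exI[of _ 0])

lemma implicit_scheme_SUP_le:
  assumes "0 < \<alpha>" "0 \<le> lam" "0 \<le> T"
  shows "\<exists>C>0. \<forall>x0>0. \<forall>k>0. \<forall>X. k powr \<alpha> * lam \<le> 1 / 2 * coeff_c \<alpha> 0 \<longrightarrow>
    implicit_scheme \<alpha> lam k x0 X \<longrightarrow> (SUP n\<in>{n. real n * k \<le> T}. X n) \<le> C * X 0"
proof (intro exI[of _ "4 * exp (gronwall_rate \<alpha> lam * T)"] conjI allI impI cSUP_grid_le)
  fix x0 k :: real and X n
  assume "0 < x0" "0 < k" "k powr \<alpha> * lam \<le> 1 / 2 * coeff_c \<alpha> 0" and X: "implicit_scheme \<alpha> lam k x0 X"
    and n: "real n * k \<le> T"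
  then have "X n \<le> 4 * x0 * exp (gronwall_rate \<alpha> lam * (real n * k))"
    using assms by (intro implicit_scheme_le) auto
  also have "\<dots> \<le> 4 * x0 * exp (gronwall_rate \<alpha> lam * T)"
    using n \<open>0 < x0\<close> by (intro mult_left_mono) (auto simp: gronwall_rate_def intro!: mult_left_mono)
  finally show "X n \<le> 4 * exp (gronwall_rate \<alpha> lam * T) * X 0"
    using X by (simp add: implicit_scheme_def mult_ac)
qed (use assms in auto)

lemma implicit_scheme_SUP_error:
  assumes \<alpha>: "0 < \<alpha>" "\<alpha> < 1" and T: "0 \<le> T"
  shows "\<exists>C. \<forall>\<^sub>F k in at_right 0. \<forall>X. implicit_scheme \<alpha> lam k x0 X \<longrightarrow>
    (SUP n\<in>{n. real n * k \<le> T}. \<bar>X n - exact_sol \<alpha> lam x0 (real n * k)\<bar>) \<le> C * k powr \<alpha>"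
proof -
  obtain C where C: "\<And>k X n. \<lbrakk>0 < k; k powr \<alpha> * \<bar>lam\<bar> \<le> 1 / 2 * coeff_c \<alpha> 0; implicit_scheme \<alpha> lam k x0 X;
      real n * k \<le> T\<rbrakk> \<Longrightarrow> \<bar>X n - exact_sol \<alpha> lam x0 (real n * k)\<bar> \<le> C * k powr \<alpha>"
    using implicit_scheme_error[OF \<alpha>] by metis
  have "((\<lambda>k. k powr \<alpha> * \<bar>lam\<bar>) \<longlongrightarrow> 0) (at_right 0)"
    using \<alpha> by real_asymp
  then have "\<forall>\<^sub>F k in at_right 0. k powr \<alpha> * \<bar>lam\<bar> < 1 / 2 * coeff_c \<alpha> 0"
    by (rule order_tendstoD) (use \<alpha> in \<open>simp add: coeff_c_0\<close>)
  then have "\<forall>\<^sub>F k in at_right 0. \<forall>X. implicit_scheme \<alpha> lam k x0 X \<longrightarrow>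
      (SUP n\<in>{n. real n * k \<le> T}. \<bar>X n - exact_sol \<alpha> lam x0 (real n * k)\<bar>) \<le> C * k powr \<alpha>"
    using eventually_at_right_less[of 0]
  proof eventually_elim
    case (elim k)
    then show ?case using C T by (intro allI impI cSUP_grid_le) auto
  qed
  then show ?thesis ..
qed

theorem theorem3p2:
  fixes \<alpha> lam :: real
  assumes "0 < \<alpha>" and "\<alpha> < 1"
  shows
    "(\<forall>x0>0. \<forall>X. fode_solution \<alpha> lam x0 X \<longleftrightarrow> (\<forall>t\<ge>0. X t = exact_sol \<alpha> lam x0 t)) \<and>
     (\<forall>k>0. \<forall>X.
        (\<forall>n\<ge>1. discrete_caputo \<alpha> k X n = lam * X n) \<longleftrightarrow>
        (\<forall>n\<ge>1. X n = X 0 + lam * k powr \<alpha> * (\<Sum>m=1..n. coeff_a \<alpha> (n - m) * X m))) \<and>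
     (lam > 0 \<longrightarrow>
        (\<forall>x0>0. \<forall>k>0. \<forall>X.
           k powr \<alpha> * lam < coeff_c \<alpha> 0 \<longrightarrow> implicit_scheme \<alpha> lam k x0 X \<longrightarrow>
           (\<forall>n. exact_sol \<alpha> lam x0 (real n * k) \<le> X n \<and> X n \<le> X (Suc n)))) \<and>
     (lam < 0 \<longrightarrow>
        (\<forall>x0>0. \<forall>k>0. \<forall>X. implicit_scheme \<alpha> lam k x0 X \<longrightarrow> X \<longlonglongrightarrow> 0)) \<and>
     (lam > 0 \<longrightarrow>
        (\<forall>x0>0. \<forall>k1>0. \<forall>k2>0. \<forall>m1::nat. \<forall>X1 X2.
           k1 powr \<alpha> * lam < coeff_c \<alpha> 0 \<longrightarrow> k2 powr \<alpha> * lam < coeff_c \<alpha> 0 \<longrightarrow>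
           k1 = 2 ^ m1 * k2 \<longrightarrow>
           implicit_scheme \<alpha> lam k1 x0 X1 \<longrightarrow> implicit_scheme \<alpha> lam k2 x0 X2 \<longrightarrow>
           (\<forall>t>0. pw_const k1 X1 t \<ge> pw_const k2 X2 t))) \<and>
     (lam > 0 \<longrightarrow>
        (\<forall>T>0. \<exists>C>0. \<forall>x0>0. \<forall>k>0. \<forall>X.
           k powr \<alpha> * lam \<le> 1 / 2 * coeff_c \<alpha> 0 \<longrightarrow> implicit_scheme \<alpha> lam k x0 X \<longrightarrow>
           (SUP n\<in>{n. real n * k \<le> T}. X n) \<le> C * X 0)) \<and>
     (\<forall>x0>0. \<forall>T>0. \<exists>C1. \<forall>\<^sub>F k in at_right 0. \<forall>X.
        implicit_scheme \<alpha> lam k x0 X \<longrightarrow>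
        (SUP n\<in>{n. real n * k \<le> T}. \<bar>X n - exact_sol \<alpha> lam x0 (real n * k)\<bar>) \<le> C1 * k powr \<alpha>)"
proof (intro conjI allI impI, goal_cases equivalence volterra lower_bound increasing decay refinement stability error)
  case (equivalence x0 X)
  show ?case by (rule fode_solution_iff_exact_sol[OF assms])
next
  case (volterra k X)
  show ?case
    by (rule discrete_caputo_eq_iff_volterra[OF assms(1) volterra, unfolded volterra_conv_def])
next
  case (lower_bound x0 k X n)
  then show ?case using assms by (intro exact_sol_le_implicit_scheme) auto
next
  case (increasing x0 k X n)
  then show ?case using assms by (intro incseq_SucD[OF implicit_scheme_incseq]) auto
next
  case (decay x0 k X)
  then show ?case using assms by (intro implicit_scheme_tendsto_0) auto
next
  case (refinement x0 k1 k2 m1 X1 X2 t)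
  then show ?case using assms pw_const_refine_le[of \<alpha> lam k2 "2 ^ m1" x0 X1 X2 t] by simp
next
  case (stability T)
  then show ?case using assms by (intro implicit_scheme_SUP_le) auto
next
  case (error x0 T)
  then show ?case using assms by (intro implicit_scheme_SUP_error) auto
qed

end
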